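(* Let $\Gamma$ be a finite graph with set of edges $E$, let $G=2^E$, let $\mathcal{D}\subset G$ be the set of dimer coverings of $\Gamma$, and let $\omega:X_G\to I^E$ be the evaluation map. The restriction of $\omega$ to the dimer complex $X_{\mathcal{D}}$ is an embedding whose image is a path-connected component $L_0(\Gamma)$ of the space of dimer labelings $L(\Gamma)\subset I^E$ (the image being empty if $\mathcal{D}=\emptyset$). The component $L_0(\Gamma)$ contains all dimer labelings associated with dimer coverings of $\Gamma$.
   Context: $I=[0,1]$. A graph is a 1-dimensional CW-complex without loops (multiple edges are allowed); finite means finitely many vertices and edges. The power group $G=2^E$ is the set of subsets of $E$ with multiplication $AB=(A\cup B)\setminus(A\cap B)$. A dimer covering is a set of edges such that every vertex of $\Gamma$ is incident to exactly one edge in the set. A dimer labeling of $\Gamma$ is a labeling of the edges by non-negative real numbers such that for every vertex the labels of the incident edges sum up to $1$ and only one or two of these labels may be non-zero; the set $L(\Gamma)\subset I^E$ of dimer labelings has the induced topology. The dimer labeling associated with a dimer covering is its characteristic function. A set $s\subset E$ is cyclic if it is finite and each vertex of $\Gamma$ is either incident to exactly two distinct edges belonging to $s$ or not incident to any edge belonging to $s$. A cyclic set is a cycle if the union of its edges is a single circle; a cycle is even if it has an even number of elements. Two sets of edges $s,t$ are independent if no edge in $s$ has a common vertex with an edge in $t$. For a finite set $S$ of pairwise independent even cycles, put $[S]=\prod_{s\in S}s\in G$, $[\emptyset]=\emptyset$. A based cube is a pair $(A,S)$ with $A\in G$ and $S$ a finite set of pairwise independent even cycles; its vertices are the elements $[T]A$,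 $T\subset S$. Based cubes $(A,S)$ and $([T]A,S)$ with $T\subset S$ are equivalent; equivalence classes are called cubes in $G$. The cubed complex $X_G$ consists of triples $(A,S,x)$ with $(A,S)$ a based cube and $x:S\to I$, modulo the equivalence relation generated by: $(A,S,x)\sim(A,S',x')$ if $S\subset S'$, $x=x'|_S$, $x'(S'\setminus S)=0$; and $(A,S,x)\sim([T]A,S,x')$ if $T\subset S$, $x'=x$ on $S\setminus T$, $x'(t)=1-x(t)$ for $t\in T$. The dimer complex $X_{\mathcal{D}}\subset X_G$ is the subcomplex formed by the cubes all of whose vertices lie in $\mathcal{D}$; it is empty if $\mathcal{D}=\emptyset$. The evaluation map $\omega:X_G\to I^E$ carries the point $a$ represented by $(A,S,x)$ to the function $\omega(a):E\to I$ with $\omega(a)(e)=x(s)$ if $e\in s\setminus A$ with $s\in S$; $\omega(a)(e)=1-x(s)$ if $e\in s\cap A$ with $s\in S$; and $\omega(a)(e)=\delta_A(e)$ for all other $e\in E$, where $\delta_A$ is the characteristic function of $A$. This is a well-defined continuous map. *)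

theory Defs
  imports "HOL-Analysis.Analysis" "HOL-Algebra.FiniteProduct"
begin

section \<open>Graphs\<close>

text \<open>A loopless graph with multiple edges allowed is given by its combinatorial data:
  each edge has a set of exactly two end points.\<close>

record ('v, 'e) multigraph =
  verts :: "'v set"
  edges :: "'e set"
  ends :: "'e \<Rightarrow> 'v set"

definition loopless_graph :: "('v, 'e) multigraph \<Rightarrow> bool" where
  "loopless_graph \<Gamma> \<longleftrightarrow> (\<forall>e\<in>edges \<Gamma>. ends \<Gamma> e \<subseteq> verts \<Gamma> \<and> card (ends \<Gamma> e) = 2)"

definition finite_loopless_graph :: "('v, 'e) multigraph \<Rightarrow> bool" where
  "finite_loopless_graph \<Gamma> \<longleftrightarrow>
     loopless_graph \<Gamma> \<and> finite (verts \<Gamma>) \<and> finite (edges \<Gamma>)"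


section \<open>Dimer coverings and dimer labelings\<close>

definition dimer_coverings :: "('v, 'e) multigraph \<Rightarrow> 'e set set" where
  "dimer_coverings \<Gamma> =
     {A. A \<subseteq> edges \<Gamma> \<and> (\<forall>v\<in>verts \<Gamma>. \<exists>!e. e \<in> A \<and> v \<in> ends \<Gamma> e)}"

abbreviation unit_interval :: "real topology" where
  "unit_interval \<equiv> top_of_set {0..1}"

text \<open>The cube \<open>I\<^sup>J\<close>; its points are the functions \<open>J \<rightarrow> I\<close>, extended by \<open>undefined\<close> outside \<open>J\<close>.\<close>

definition cube_space :: "'a set \<Rightarrow> ('a \<Rightarrow> real) topology" where
  "cube_space J = product_topology (\<lambda>_. unit_interval) J"

lemma topspace_cube_space [simp]: "topspace (cube_space J) = (J \<rightarrow>\<^sub>E {0..1})"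
  by (simp add: cube_space_def)

text \<open>The sum below is only meaningful for vertices with finitely many incident edges.\<close>

definition dimer_labelings :: "('v, 'e) multigraph \<Rightarrow> ('e \<Rightarrow> real) set" where
  "dimer_labelings \<Gamma> =
     {l \<in> edges \<Gamma> \<rightarrow>\<^sub>E {0..}. \<forall>v\<in>verts \<Gamma>.
        (\<Sum>e | e \<in> edges \<Gamma> \<and> v \<in> ends \<Gamma> e. l e) = 1 \<and>
        card {e \<in> edges \<Gamma>. v \<in> ends \<Gamma> e \<and> l e \<noteq> 0} \<in> {1, 2}}"

lemma dimer_labelings_subset_cube:
  assumes "finite_loopless_graph \<Gamma>"
  shows "dimer_labelings \<Gamma> \<subseteq> topspace (cube_space (edges \<Gamma>))"
proof
  fix l assume l: "l \<in> dimer_labelings \<Gamma>"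
  have "l e \<le> 1" if e: "e \<in> edges \<Gamma>" for e
  proof -
    have "ends \<Gamma> e \<noteq> {}" and sub: "ends \<Gamma> e \<subseteq> verts \<Gamma>"
      using assms e by (auto simp: finite_loopless_graph_def loopless_graph_def)
    then obtain v where v: "v \<in> ends \<Gamma> e" "v \<in> verts \<Gamma>" by blast
    have "l e \<le> (\<Sum>e | e \<in> edges \<Gamma> \<and> v \<in> ends \<Gamma> e. l e)"
      by (rule member_le_sum)
        (use l assms v e in \<open>auto simp: dimer_labelings_def finite_loopless_graph_def PiE_iff\<close>)
    then show ?thesis using l v by (simp add: dimer_labelings_def)
  qed
  then show "l \<in> topspace (cube_space (edges \<Gamma>))"
    using l by (auto simp: dimer_labelings_def PiE_iff)
qed

definition labeling_space :: "('v, 'e) multigraph \<Rightarrow> ('e \<Rightarrow> real) topology" where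
  "labeling_space \<Gamma> = subtopology (cube_space (edges \<Gamma>)) (dimer_labelings \<Gamma>)"

definition char_labeling :: "('v, 'e) multigraph \<Rightarrow> 'e set \<Rightarrow> 'e \<Rightarrow> real" where
  "char_labeling \<Gamma> A = (\<lambda>e\<in>edges \<Gamma>. indicator A e)"


section \<open>Even cycles\<close>

definition cyclic_set :: "('v, 'e) multigraph \<Rightarrow> 'e set \<Rightarrow> bool" where
  "cyclic_set \<Gamma> s \<longleftrightarrow> s \<subseteq> edges \<Gamma> \<and> finite s \<and>
     (\<forall>v\<in>verts \<Gamma>. card {e \<in> s. v \<in> ends \<Gamma> e} \<in> {0, 2})"

text \<open>The union of the edges in \<open>s\<close> is a single circle if the edges can be enumerated
  as a closed walk without repeated edges or vertices. For a circle of length two,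
  the two edges are parallel.\<close>

definition is_circle :: "('v, 'e) multigraph \<Rightarrow> 'e set \<Rightarrow> bool" where
  "is_circle \<Gamma> s \<longleftrightarrow> (\<exists>vs es.
     vs \<noteq> [] \<and> length es = length vs \<and> distinct vs \<and> distinct es \<and>
     set vs \<subseteq> verts \<Gamma> \<and> set es = s \<and>
     (\<forall>i<length vs. ends \<Gamma> (es ! i) = {vs ! i, vs ! (Suc i mod length vs)}))"

definition is_cycle :: "('v, 'e) multigraph \<Rightarrow> 'e set \<Rightarrow> bool" where
  "is_cycle \<Gamma> s \<longleftrightarrow> cyclic_set \<Gamma> s \<and> is_circle \<Gamma> s"

definition even_cycle :: "('v, 'e) multigraph \<Rightarrow> 'e set \<Rightarrow> bool" where
  "even_cycle \<Gamma> s \<longleftrightarrow> is_cycle \<Gamma> s \<and> even (card s)"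

definition independent_sets :: "('v, 'e) multigraph \<Rightarrow> 'e set \<Rightarrow> 'e set \<Rightarrow> bool" where
  "independent_sets \<Gamma> s t \<longleftrightarrow> (\<forall>e\<in>s. \<forall>f\<in>t. ends \<Gamma> e \<inter> ends \<Gamma> f = {})"

definition cycle_families :: "('v, 'e) multigraph \<Rightarrow> 'e set set set" where
  "cycle_families \<Gamma> = {S. finite S \<and> (\<forall>s\<in>S. even_cycle \<Gamma> s) \<and>
                            pairwise (independent_sets \<Gamma>) S}"


section \<open>The power group\<close>

definition power_group :: "'e set \<Rightarrow> 'e set monoid" where
  "power_group E = \<lparr>carrier = Pow E, mult = (\<lambda>A B. (A \<union> B) - (A \<inter> B)), one = {}\<rparr>"

lemma power_group_simps [simp]:
  "carrier (power_group E) = Pow E"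
  "A \<otimes>\<^bsub>power_group E\<^esub> B = (A \<union> B) - (A \<inter> B)"
  "\<one>\<^bsub>power_group E\<^esub> = {}"
  by (simp_all add: power_group_def)

lemma comm_group_power_group: "comm_group (power_group E)"
  by (rule comm_groupI) auto

text \<open>\<open>fprod \<Gamma> S\<close> is the product \<open>[S]\<close> in the power group of the set of edges.\<close>

definition fprod :: "('v, 'e) multigraph \<Rightarrow> 'e set set \<Rightarrow> 'e set" where
  "fprod \<Gamma> S = finprod (power_group (edges \<Gamma>)) (\<lambda>s. s) S"

definition translate :: "('v, 'e) multigraph \<Rightarrow> 'e set set \<Rightarrow> 'e set \<Rightarrow> 'e set" where
  "translate \<Gamma> T A = fprod \<Gamma> T \<otimes>\<^bsub>power_group (edges \<Gamma>)\<^esub> A"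


section \<open>The cubed complex\<close>

definition based_cubes :: "('v, 'e) multigraph \<Rightarrow> ('e set \<times> 'e set set) set" where
  "based_cubes \<Gamma> = carrier (power_group (edges \<Gamma>)) \<times> cycle_families \<Gamma>"

definition cube_vertices :: "('v, 'e) multigraph \<Rightarrow> 'e set \<times> 'e set set \<Rightarrow> 'e set set" where
  "cube_vertices \<Gamma> = (\<lambda>(A, S). {translate \<Gamma> T A |T. T \<subseteq> S})"

type_synonym 'e triple = "('e set \<times> 'e set set) \<times> ('e set \<Rightarrow> real)"

text \<open>The disjoint union of one copy of \<open>I\<^sup>S\<close> for every based cube \<open>(A, S)\<close>;
  its points are the triples \<open>((A, S), x)\<close>.\<close>

definition triple_space :: "('v, 'e) multigraph \<Rightarrow> 'e triple topology" where
  "triple_space \<Gamma> = sum_topology (\<lambda>(A, S). cube_space S) (based_cubes \<Gamma>)"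

lemma triple_in_topspace_iff:
  "((A, S), x) \<in> topspace (triple_space \<Gamma>) \<longleftrightarrow>
     A \<subseteq> edges \<Gamma> \<and> S \<in> cycle_families \<Gamma> \<and> x \<in> S \<rightarrow>\<^sub>E {0..1}"
  by (auto simp: triple_space_def based_cubes_def)

inductive glue :: "('v, 'e) multigraph \<Rightarrow> 'e triple \<Rightarrow> 'e triple \<Rightarrow> bool" for \<Gamma> where
  face: "\<lbrakk>((A, S), x) \<in> topspace (triple_space \<Gamma>); ((A, S'), x') \<in> topspace (triple_space \<Gamma>);
    S \<subseteq> S'; x = restrict x' S; \<forall>s\<in>S' - S. x' s = 0\<rbrakk>
    \<Longrightarrow> glue \<Gamma> ((A, S), x) ((A, S'), x')"
| rebase: "\<lbrakk>((A, S), x) \<in> topspace (triple_space \<Gamma>);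
    ((translate \<Gamma> T A, S), x') \<in> topspace (triple_space \<Gamma>);
    T \<subseteq> S; \<forall>s\<in>S - T. x' s = x s; \<forall>t\<in>T. x' t = 1 - x t\<rbrakk>
    \<Longrightarrow> glue \<Gamma> ((A, S), x) ((translate \<Gamma> T A, S), x')"

definition glue_rel :: "('v, 'e) multigraph \<Rightarrow> ('e triple \<times> 'e triple) set" where
  "glue_rel \<Gamma> = {(p, q). p \<in> topspace (triple_space \<Gamma>) \<and> q \<in> topspace (triple_space \<Gamma>) \<and>
                          equivclp (glue \<Gamma>) p q}"

lemma equiv_glue_rel: "equiv (topspace (triple_space \<Gamma>)) (glue_rel \<Gamma>)"
  by (rule equivI)
    (auto simp: glue_rel_def refl_on_def sym_def trans_def
      intro: equivclp_sym equivclp_trans)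

definition quotient_topology :: "'a topology \<Rightarrow> ('a \<times> 'a) set \<Rightarrow> 'a set topology" where
  "quotient_topology X r = topology (\<lambda>\<U>. \<U> \<subseteq> topspace X // r \<and> openin X (\<Union>\<U>))"

lemma openin_quotient_topology:
  assumes r: "equiv (topspace X) r"
  shows "openin (quotient_topology X r) \<U> \<longleftrightarrow> \<U> \<subseteq> topspace X // r \<and> openin X (\<Union>\<U>)"
proof -
  have int: "\<Union>(\<U> \<inter> \<V>) = \<Union>\<U> \<inter> \<Union>\<V>"
    if "\<U> \<subseteq> topspace X // r" "\<V> \<subseteq> topspace X // r" for \<U> \<V>
    using that quotient_disj[OF r] by fast
  have un: "\<Union>(\<Union>\<K>) = (\<Union>\<U>\<in>\<K>. \<Union>\<U>)" for \<K> :: "'a set set set" by blast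
  have "istopology (\<lambda>\<U>. \<U> \<subseteq> topspace X // r \<and> openin X (\<Union>\<U>))"
    unfolding istopology_def
  proof (intro conjI allI impI)
    fix \<U> \<V>
    assume "\<U> \<subseteq> topspace X // r \<and> openin X (\<Union>\<U>)" "\<V> \<subseteq> topspace X // r \<and> openin X (\<Union>\<V>)"
    then show "\<U> \<inter> \<V> \<subseteq> topspace X // r" "openin X (\<Union>(\<U> \<inter> \<V>))"
      by (auto simp only: int openin_Int)
  next
    fix \<K> assume K: "\<forall>\<U>\<in>\<K>. \<U> \<subseteq> topspace X // r \<and> openin X (\<Union>\<U>)"
    show "\<Union>\<K> \<subseteq> topspace X // r" using K by blast
    show "openin X (\<Union>(\<Union>\<K>))" unfolding un using K by blast
  qed
  then show ?thesis by (simp add: quotient_topology_def)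
qed

lemma topspace_quotient_topology:
  assumes r: "equiv (topspace X) r"
  shows "topspace (quotient_topology X r) = topspace X // r"
proof -
  have "openin (quotient_topology X r) (topspace X // r)"
    by (simp add: openin_quotient_topology[OF r] Union_quotient[OF r])
  then show ?thesis
    by (metis openin_quotient_topology[OF r] openin_subset openin_topspace subset_antisym)
qed

definition cubed_complex :: "('v, 'e) multigraph \<Rightarrow> 'e triple set topology" where
  "cubed_complex \<Gamma> = quotient_topology (triple_space \<Gamma>) (glue_rel \<Gamma>)"

definition dimer_complex :: "('v, 'e) multigraph \<Rightarrow> 'e triple set topology" where
  "dimer_complex \<Gamma> = subtopology (cubed_complex \<Gamma>)
     {a. \<exists>A S x. ((A, S), x) \<in> a \<and> cube_vertices \<Gamma> (A, S) \<subseteq> dimer_coverings \<Gamma>}"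


section \<open>The evaluation map\<close>

definition eval_triple :: "('v, 'e) multigraph \<Rightarrow> 'e triple \<Rightarrow> 'e \<Rightarrow> real" where
  "eval_triple \<Gamma> = (\<lambda>((A, S), x). \<lambda>e\<in>edges \<Gamma>.
     if \<exists>s\<in>S. e \<in> s then
       let s = (THE s. s \<in> S \<and> e \<in> s) in if e \<in> A then 1 - x s else x s
     else indicator A e)"

definition eval_map :: "('v, 'e) multigraph \<Rightarrow> 'e triple set \<Rightarrow> 'e \<Rightarrow> real" where
  "eval_map \<Gamma> a = the_elem (eval_triple \<Gamma> ` a)"

text \<open>The following lemmas confirm that \<open>eval_map\<close> does not depend on representatives.\<close>

lemma cycle_families_disjoint:
  assumes "loopless_graph \<Gamma>" "S \<in> cycle_families \<Gamma>" "s \<in> S" "t \<in> S" "e \<in> s" "e \<in> t"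
  shows "s = t"
proof (rule ccontr)
  assume "s \<noteq> t"
  then have "independent_sets \<Gamma> s t"
    using assms by (auto simp: cycle_families_def pairwise_def)
  then have "ends \<Gamma> e = {}" using assms by (auto simp: independent_sets_def)
  moreover have "e \<in> edges \<Gamma>"
    using assms by (auto simp: cycle_families_def even_cycle_def is_cycle_def cyclic_set_def)
  ultimately show False using assms by (auto simp: loopless_graph_def)
qed

lemma fprod_eq_Union:
  assumes "loopless_graph \<Gamma>" "T \<in> cycle_families \<Gamma>"
  shows "fprod \<Gamma> T = \<Union>T"
proof -
  interpret comm_group "power_group (edges \<Gamma>)" by (rule comm_group_power_group)
  have "finite T" using assms by (simp add: cycle_families_def)
  then show ?thesis using assms(2)
  proof (induction T)
    case empty
    then show ?case by (simp add: fprod_def)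
  next
    case (insert t T)
    have T: "T \<in> cycle_families \<Gamma>"
      using insert.prems by (auto simp: cycle_families_def pairwise_def)
    have sub: "s \<subseteq> edges \<Gamma>" if "s \<in> insert t T" for s
      using insert.prems that
      by (auto simp: cycle_families_def even_cycle_def is_cycle_def cyclic_set_def)
    have "t \<inter> \<Union>T = {}"
      using cycle_families_disjoint[OF assms(1) insert.prems] insert.hyps by blast
    moreover have "fprod \<Gamma> (insert t T) = t \<otimes>\<^bsub>power_group (edges \<Gamma>)\<^esub> fprod \<Gamma> T"
      unfolding fprod_def using insert.hyps sub by (intro finprod_insert) auto
    ultimately show ?case using insert.IH[OF T] by auto
  qed
qed

lemma eval_triple_in:
  assumes "loopless_graph \<Gamma>" "S \<in> cycle_families \<Gamma>" "s \<in> S" "e \<in> s" "e \<in> edges \<Gamma>"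
  shows "eval_triple \<Gamma> ((A, S), x) e = (if e \<in> A then 1 - x s else x s)"
proof -
  have "(THE s. s \<in> S \<and> e \<in> s) = s"
    by (rule the_equality) (use assms cycle_families_disjoint[OF assms(1,2)] in blast)+
  moreover have "\<exists>s\<in>S. e \<in> s" using assms by blast
  ultimately show ?thesis using assms(5) by (simp add: eval_triple_def)
qed

lemma eval_triple_notin:
  assumes "e \<notin> \<Union>S" "e \<in> edges \<Gamma>"
  shows "eval_triple \<Gamma> ((A, S), x) e = indicator A e"
  using assms by (auto simp: eval_triple_def)

lemma eval_triple_glue:
  assumes G: "loopless_graph \<Gamma>" and "glue \<Gamma> p q"
  shows "eval_triple \<Gamma> p = eval_triple \<Gamma> q"
  using assms(2)
proof cases
  case (face A S x S' x')
  then have S: "S \<in> cycle_families \<Gamma>" and S': "S' \<in> cycle_families \<Gamma>"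
    by (auto simp: triple_in_topspace_iff)
  have "eval_triple \<Gamma> p e = eval_triple \<Gamma> q e" if e: "e \<in> edges \<Gamma>" for e
  proof -
    consider s where "s \<in> S" "e \<in> s" | s where "s \<in> S' - S" "e \<in> s" | "e \<notin> \<Union>S'" by blast
    then show ?thesis
    proof cases
      case (1 s)
      then have "s \<in> S'" using face by blast
      then show ?thesis
        using 1 face eval_triple_in[OF G S \<open>s \<in> S\<close> \<open>e \<in> s\<close> e] eval_triple_in[OF G S' _ \<open>e \<in> s\<close> e]
        by simp
    next
      case (2 s)
      then have "e \<notin> \<Union>S" using cycle_families_disjoint[OF G S'] face by blast
      then show ?thesis
        using 2 face eval_triple_notin[of e S, OF _ e] eval_triple_in[OF G S' _ \<open>e \<in> s\<close> e] by simp
    next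
      case 3
      then have "e \<notin> \<Union>S" using face by blast
      then show ?thesis using 3 face eval_triple_notin[OF _ e] by metis
    qed
  qed
  moreover have "eval_triple \<Gamma> p e = eval_triple \<Gamma> q e" if "e \<notin> edges \<Gamma>" for e
    using that face by (simp add: eval_triple_def)
  ultimately show ?thesis by blast
next
  case (rebase A S x T x')
  then have S: "S \<in> cycle_families \<Gamma>" by (auto simp: triple_in_topspace_iff)
  then have "T \<in> cycle_families \<Gamma>"
    using rebase(5) unfolding cycle_families_def by (blast intro: finite_subset pairwise_subset)
  then have tr: "translate \<Gamma> T A = (\<Union>T \<union> A) - (\<Union>T \<inter> A)"
    by (simp add: translate_def fprod_eq_Union[OF G])
  have "eval_triple \<Gamma> p e = eval_triple \<Gamma> q e" if e: "e \<in> edges \<Gamma>" for e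
  proof -
    consider s where "s \<in> T" "e \<in> s" | s where "s \<in> S - T" "e \<in> s" | "e \<notin> \<Union>S" by blast
    then show ?thesis
    proof cases
      case (1 s)
      then have s: "s \<in> S" and eT: "e \<in> \<Union>T" using rebase by blast+
      then have "e \<in> translate \<Gamma> T A \<longleftrightarrow> e \<notin> A" by (auto simp: tr)
      then show ?thesis using 1 rebase eval_triple_in[OF G S s \<open>e \<in> s\<close> e] by simp
    next
      case (2 s)
      then have s: "s \<in> S" and eT: "e \<notin> \<Union>T"
        using cycle_families_disjoint[OF G S] rebase by blast+
      then have "e \<in> translate \<Gamma> T A \<longleftrightarrow> e \<in> A" by (auto simp: tr)
      then show ?thesis using 2 rebase eval_triple_in[OF G S s \<open>e \<in> s\<close> e] by simp
    next
      case 3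
      then have "e \<notin> \<Union>T" using rebase by blast
      then have "e \<in> translate \<Gamma> T A \<longleftrightarrow> e \<in> A" by (auto simp: tr)
      then show ?thesis using 3 rebase eval_triple_notin[OF _ e] by (simp add: indicator_def)
    qed
  qed
  moreover have "eval_triple \<Gamma> p e = eval_triple \<Gamma> q e" if "e \<notin> edges \<Gamma>" for e
    using that rebase by (simp add: eval_triple_def)
  ultimately show ?thesis by blast
qed

lemma eval_map_class:
  assumes G: "loopless_graph \<Gamma>" and a: "a \<in> topspace (cubed_complex \<Gamma>)" and p: "p \<in> a"
  shows "eval_map \<Gamma> a = eval_triple \<Gamma> p"
proof -
  have a': "a \<in> topspace (triple_space \<Gamma>) // glue_rel \<Gamma>"
    using a by (simp add: cubed_complex_def topspace_quotient_topology[OF equiv_glue_rel])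
  have "eval_triple \<Gamma> q = eval_triple \<Gamma> p" if "q \<in> a" for q
  proof -
    have "(p, q) \<in> glue_rel \<Gamma>"
      using quotient_eq_iff[OF equiv_glue_rel a' a' p that] by simp
    then have "equivclp (glue \<Gamma>) p q" by (simp add: glue_rel_def)
    then show ?thesis
      by (induction rule: equivclp_induct) (auto dest: eval_triple_glue[OF G])
  qed
  then have "eval_triple \<Gamma> ` a = (\<lambda>_. eval_triple \<Gamma> p) ` a" by (rule image_cong[OF refl])
  also have "\<dots> = {eval_triple \<Gamma> p}" using p by blast
  finally have "eval_triple \<Gamma> ` a = {eval_triple \<Gamma> p}" .
  then show ?thesis by (simp add: eval_map_def)
qed

end

theory Submission
  imports Defs
begin

text \<open>
  At each vertex, a dimer labeling has a single label \<open>1\<close> or two positive labels \<open>a\<close> and \<open>1 - a\<close>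
  (\<open>dimer_labeling_vertex_cases\<close>). Hence the edges whose label lies strictly between \<open>0\<close> and \<open>1\<close> form
  a cyclic set, which is the union of a unique family \<open>S\<close> of independent cycles
  (\<open>cyclic_set_decomposition\<close>, \<open>cyclic_set_decomposition_unique\<close>). Along each of these cycles the
  labels alternate between \<open>a\<close> and \<open>1 - a\<close>. On an odd cycle this forces \<open>a = 1/2\<close>.

  If all these cycles are even, then the edges with label \<open>1\<close> together with every other edge of each
  cycle form a dimer covering \<open>A\<close>, and the labeling is the value of \<open>\<omega>\<close> at the point of the cube
  \<open>(A, S)\<close> whose coordinates are the numbers \<open>a\<close>. Conversely, a dimer covering whose flips along the
  cycles of \<open>S\<close> are again dimer coverings alternates along each of them
  (\<open>cube_of_dimer_coverings_iff\<close>), which no set of edges can do along an odd cycle. So the image of \<open>\<omega>\<close> consists of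
  the dimer labelings for which no odd cycle has positive labels throughout (\<open>eval_map_image\<close>).

  The map is injective, because the labeling determines \<open>S\<close>, and two dimer coverings which
  alternate along a cycle agree or are complementary on it; the complementary case is accounted for by the rebasing
  relation of the cubed complex (\<open>interior_triples_glued\<close>). As the dimer complex is compact, \<open>\<omega>\<close> is
  an embedding.

  It remains to see that the image is a path component. Straight segments of dimer labelings join
  each of its points to the labeling of a dimer covering, and the labelings of any two dimer coverings
  to each other. No path leaves the image, because it is open and closed in the space of dimer
  labelings: the labelings that are positive on a given odd cycle form an open set, and they are
  exactly those with all labels \<open>1/2\<close> on this cycle, which form a closed set
  (\<open>odd_cycle_free_labelings_clopen\<close>).
\<close>

section \<open>Circles as cyclic orders of edges\<close>

definition adjacent_edges :: "('v, 'e) multigraph \<Rightarrow> 'e \<Rightarrow> 'e \<Rightarrow> bool" where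
  "adjacent_edges \<Gamma> e f \<longleftrightarrow> e \<noteq> f \<and> ends \<Gamma> e \<inter> ends \<Gamma> f \<noteq> {}"

text \<open>
  The circle, seen as a cyclic order of its edges, so that adjacency becomes a condition on
  indices modulo the length. At least two edges occur, as a single edge closing up would be a
  loop; for two parallel edges the two successor conditions coincide.
\<close>

lemma circle_enumeration:
  assumes "loopless_graph \<Gamma>" "c \<subseteq> edges \<Gamma>" "is_circle \<Gamma> c"
  obtains n e v where "2 \<le> n" "bij_betw e {..<n} c"
    "\<And>i. i < n \<Longrightarrow> ends \<Gamma> (e i) = {v i, v (Suc i mod n)}"
    "\<And>i j. i < n \<Longrightarrow> j < n \<Longrightarrow>
      adjacent_edges \<Gamma> (e i) (e j) \<longleftrightarrow> j = Suc i mod n \<or> i = Suc j mod n"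
proof -
  obtain vs es where vs: "vs \<noteq> []" "distinct vs" and len: "length es = length vs"
    and es: "distinct es" "set es = c"
    and ends: "\<And>i. i < length vs \<Longrightarrow> ends \<Gamma> (es ! i) = {vs ! i, vs ! (Suc i mod length vs)}"
    using assms(3) by (auto simp: is_circle_def)
  define n where "n = length vs"
  have pos: "0 < n" using vs by (simp add: n_def)
  have "card (ends \<Gamma> (es ! 0)) = 2"
    using assms(1,2) es len pos unfolding loopless_graph_def n_def by (metis nth_mem subsetD)
  then have "n \<noteq> 1" using ends[of 0] vs by (auto simp: n_def)
  then have n: "2 \<le> n" using pos by linarith
  have bij: "bij_betw ((!) es) {..<n} c"
    using es len by (auto intro: bij_betw_nth simp: n_def)
  have adj: "adjacent_edges \<Gamma> (es ! i) (es ! j) \<longleftrightarrow> j = Suc i mod n \<or> i = Suc j mod n"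
    if ij: "i < n" "j < n" for i j
  proof -
    have 1: "es ! i = es ! j \<longleftrightarrow> i = j"
      using es len ij by (simp add: n_def nth_eq_iff_index_eq)
    have 2: "vs ! a = vs ! b \<longleftrightarrow> a = b" if "a < n" "b < n" for a b
      using vs that by (simp add: n_def nth_eq_iff_index_eq)
    have 3: "Suc i mod n < n" "Suc j mod n < n" using pos by auto
    have 4: "Suc i mod n = Suc j mod n \<longleftrightarrow> i = j" using ij by (auto simp: mod_Suc)
    have 5: "Suc i mod n \<noteq> i" using n ij by (auto simp: mod_Suc split: if_splits)
    have "ends \<Gamma> (es ! i) \<inter> ends \<Gamma> (es ! j) \<noteq> {} \<longleftrightarrow>
        vs ! i = vs ! j \<or> vs ! i = vs ! (Suc j mod n) \<or>
        vs ! (Suc i mod n) = vs ! j \<or> vs ! (Suc i mod n) = vs ! (Suc j mod n)"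
      unfolding ends[OF ij(1)[unfolded n_def]] ends[OF ij(2)[unfolded n_def]] n_def by blast
    also have "\<dots> \<longleftrightarrow> i = j \<or> i = Suc j mod n \<or> Suc i mod n = j"
      unfolding 2[OF ij] 2[OF ij(1) 3(2)] 2[OF 3(1) ij(2)] 2[OF 3] 4 by blast
    finally show ?thesis using 1 5 unfolding adjacent_edges_def by metis
  qed
  show ?thesis using that[OF n bij _ adj, of "(!) vs"] ends by (simp add: n_def)
qed

text \<open>
  Connectedness of a circle, in the form in which it is used: whatever passes from an edge to
  its neighbours passes to all edges.
\<close>

lemma circle_induct:
  assumes "loopless_graph \<Gamma>" "c \<subseteq> edges \<Gamma>" "is_circle \<Gamma> c"
    and "e0 \<in> c" "P e0"
    and step: "\<And>e f. e \<in> c \<Longrightarrow> f \<in> c \<Longrightarrow> adjacent_edges \<Gamma> e f \<Longrightarrow> P e \<Longrightarrow> P f"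
    and "f \<in> c"
  shows "P f"
proof -
  obtain n e where n: "2 \<le> n" and e: "bij_betw e {..<n} c"
    and adj: "\<And>i j. i < n \<Longrightarrow> j < n \<Longrightarrow>
      adjacent_edges \<Gamma> (e i) (e j) \<longleftrightarrow> j = Suc i mod n \<or> i = Suc j mod n"
    using circle_enumeration[OF assms(1-3)] by metis
  obtain k where k: "k < n" "e k = e0" using e \<open>e0 \<in> c\<close> by (auto simp: bij_betw_def)
  obtain j where j: "j < n" "e j = f" using e \<open>f \<in> c\<close> by (auto simp: bij_betw_def)
  have c: "e i \<in> c" if "i < n" for i using e that by (auto simp: bij_betw_def)
  have "P (e ((k + m) mod n))" for m
  proof (induction m)
    case 0
    then show ?case using k assms by simp
  next
    case (Suc m)
    have lt: "(k + m) mod n < n" "(k + Suc m) mod n < n" using n by auto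
    have "(k + Suc m) mod n = Suc ((k + m) mod n) mod n" by (simp add: mod_Suc_eq)
    then have "adjacent_edges \<Gamma> (e ((k + m) mod n)) (e ((k + Suc m) mod n))"
      using adj[OF lt] by blast
    then show ?case using step c lt Suc by blast
  qed
  from this[of "n + j - k"] show ?thesis using k j by simp
qed

lemma circle_nonempty: "is_circle \<Gamma> c \<Longrightarrow> c \<noteq> {}"
  unfolding is_circle_def by (metis length_0_conv set_empty)

text \<open>
  Walking once around the circle turns the value \<open>a\<close> at the first edge into
  \<open>1 - a\<close> after an odd number of steps, so \<open>a = 1 - a\<close>.
\<close>

lemma alternating_on_odd_circle:
  fixes h :: "'e \<Rightarrow> real"
  assumes "loopless_graph \<Gamma>" "c \<subseteq> edges \<Gamma>" "is_circle \<Gamma> c"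
    and odd: "odd (card c)"
    and h: "\<And>e f. e \<in> c \<Longrightarrow> f \<in> c \<Longrightarrow> adjacent_edges \<Gamma> e f \<Longrightarrow> h e + h f = 1"
    and "f \<in> c"
  shows "h f = 1 / 2"
proof -
  obtain n e where n: "2 \<le> n" and e: "bij_betw e {..<n} c"
    and adj: "\<And>i j. i < n \<Longrightarrow> j < n \<Longrightarrow>
      adjacent_edges \<Gamma> (e i) (e j) \<longleftrightarrow> j = Suc i mod n \<or> i = Suc j mod n"
    using circle_enumeration[OF assms(1-3)] by metis
  have c: "e i \<in> c" if "i < n" for i using e that by (auto simp: bij_betw_def)
  have "odd n" using odd bij_betw_same_card[OF e] by simp
  then obtain k where k: "n = Suc (2 * k)" by (auto elim: oddE)
  have alt: "h (e i) = (if even i then h (e 0) else 1 - h (e 0))" if "i < n" for i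
    using that
  proof (induction i)
    case (Suc i)
    have "h (e i) + h (e (Suc i)) = 1" using Suc.prems adj[of i "Suc i"] h c by simp
    then show ?case using Suc by auto
  qed simp
  have "h (e (2 * k)) + h (e 0) = 1" using adj[of "2 * k" 0] h c k by simp
  then have 0: "h (e 0) = 1 / 2" using alt[of "2 * k"] k by simp
  obtain j where "j < n" "e j = f" using e \<open>f \<in> c\<close> by (auto simp: bij_betw_def)
  then show ?thesis using alt[of j] 0 by (auto split: if_splits)
qed

text \<open>
  Every other edge: taking the edges with even index is consistent at the closing vertex
  because the length is even.
\<close>

lemma even_circle_alternating_half:
  assumes "loopless_graph \<Gamma>" "c \<subseteq> edges \<Gamma>" "is_circle \<Gamma> c" "even (card c)"
  shows "\<exists>B\<subseteq>c. \<forall>e\<in>c. \<forall>f\<in>c. adjacent_edges \<Gamma> e f \<longrightarrow> (e \<in> B \<longleftrightarrow> f \<notin> B)"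
proof -
  obtain n e where n: "2 \<le> n" and e: "bij_betw e {..<n} c"
    and adj: "\<And>i j. i < n \<Longrightarrow> j < n \<Longrightarrow>
      adjacent_edges \<Gamma> (e i) (e j) \<longleftrightarrow> j = Suc i mod n \<or> i = Suc j mod n"
    using circle_enumeration[OF assms(1-3)] by metis
  have even: "even n" using assms(4) bij_betw_same_card[OF e] by simp
  define B where "B = e ` {i. i < n \<and> even i}"
  have mem: "e i \<in> B \<longleftrightarrow> even i" if "i < n" for i
    using that e by (auto simp: B_def bij_betw_def inj_on_def)
  have "(e i \<in> B \<longleftrightarrow> e j \<notin> B)" if "i < n" "j < n" "adjacent_edges \<Gamma> (e i) (e j)" for i j
  proof -
    have "even (Suc k mod n) \<longleftrightarrow> odd k" for k
      using even by (simp add: dvd_mod_iff)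
    then show ?thesis using that adj mem by auto
  qed
  moreover have "B \<subseteq> c" using e by (auto simp: B_def bij_betw_def)
  moreover have "c = e ` {..<n}" using e by (simp add: bij_betw_def)
  ultimately show ?thesis by (intro exI[of _ B]) blast
qed

text \<open>
  Complementing \<open>h\<close> on the chosen half \<open>B\<close> gives a function which
  is constant along adjacent edges. The common value \<open>a\<close> will be the coordinate
  of the circle in a cube.
\<close>

lemma alternating_on_even_circle:
  fixes h :: "'e \<Rightarrow> real"
  assumes "loopless_graph \<Gamma>" "c \<subseteq> edges \<Gamma>" "is_circle \<Gamma> c"
    and B: "\<And>e f. e \<in> c \<Longrightarrow> f \<in> c \<Longrightarrow> adjacent_edges \<Gamma> e f \<Longrightarrow> e \<in> B \<longleftrightarrow> f \<notin> B"
    and h: "\<And>e f. e \<in> c \<Longrightarrow> f \<in> c \<Longrightarrow> adjacent_edges \<Gamma> e f \<Longrightarrow> h e + h f = 1"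
  shows "\<exists>a. \<forall>e\<in>c. h e = (if e \<in> B then 1 - a else a)"
proof -
  obtain e0 where e0: "e0 \<in> c" using circle_nonempty assms by blast
  define a where "a = (if e0 \<in> B then 1 - h e0 else h e0)"
  have "h f = (if f \<in> B then 1 - a else a)" if "f \<in> c" for f
    by (rule circle_induct[OF assms(1-3) e0 _ _ that, of "\<lambda>e. h e = (if e \<in> B then 1 - a else a)"])
      (use B h in \<open>force simp: a_def split: if_splits\<close>)+
  then show ?thesis by blast
qed

section \<open>Cyclic sets decompose into independent cycles\<close>

definition edges_at :: "('v, 'e) multigraph \<Rightarrow> 'e set \<Rightarrow> 'v \<Rightarrow> 'e set" where
  "edges_at \<Gamma> F v = {e \<in> F. v \<in> ends \<Gamma> e}"

lemma cyclic_set_iff: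
  "cyclic_set \<Gamma> s \<longleftrightarrow> s \<subseteq> edges \<Gamma> \<and> finite s \<and>
     (\<forall>v\<in>verts \<Gamma>. edges_at \<Gamma> s v = {} \<or> card (edges_at \<Gamma> s v) = 2)"
proof -
  have "finite s \<Longrightarrow> card {e \<in> s. v \<in> ends \<Gamma> e} = 0 \<longleftrightarrow> {e \<in> s. v \<in> ends \<Gamma> e} = {}" for v
    by (subst card_0_eq) auto
  then show ?thesis unfolding cyclic_set_def edges_at_def by fastforce
qed

lemma circle_second_edge:
  assumes "loopless_graph \<Gamma>" "c \<subseteq> edges \<Gamma>" "is_circle \<Gamma> c" "e0 \<in> c" "w \<in> ends \<Gamma> e0"
  shows "\<exists>f\<in>c. f \<noteq> e0 \<and> w \<in> ends \<Gamma> f"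
proof -
  obtain n e v where n: "2 \<le> n" and e: "bij_betw e {..<n} c"
    and ends: "\<And>i. i < n \<Longrightarrow> ends \<Gamma> (e i) = {v i, v (Suc i mod n)}"
    using circle_enumeration[OF assms(1-3)] by metis
  have c: "e i \<in> c" if "i < n" for i using e that by (auto simp: bij_betw_def)
  have inj: "e i = e j \<longleftrightarrow> i = j" if "i < n" "j < n" for i j
    using e that by (auto simp: bij_betw_def inj_on_def)
  obtain i where i: "i < n" "e0 = e i" using e assms(4) by (auto simp: bij_betw_def)
  obtain j where j: "j < n" "Suc j mod n = i"
    using i by (cases i) (auto intro: that[of "n - 1"] that[of "i - 1"])
  have ne: "j \<noteq> i" "Suc i mod n \<noteq> i" and lt: "Suc i mod n < n"
    using i j n by (auto simp: mod_Suc split: if_splits)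
  consider "w = v i" | "w = v (Suc i mod n)" using assms(5) i ends by auto
  then show ?thesis
  proof cases
    case 1
    then show ?thesis using ends[OF j(1)] j ne i c inj by (intro bexI[of _ "e j"]) auto
  next
    case 2
    then show ?thesis using ends[OF lt] ne lt i c inj by (intro bexI[of _ "e (Suc i mod n)"]) auto
  qed
qed

text \<open>
  Both sets have exactly two edges at a vertex on \<open>c\<close>; hence a cyclic subset is
  a union of connected components.
\<close>

lemma edges_at_subcyclic:
  assumes "loopless_graph \<Gamma>" "cyclic_set \<Gamma> F" "cyclic_set \<Gamma> c" "c \<subseteq> F" "e \<in> c" "v \<in> ends \<Gamma> e"
  shows "edges_at \<Gamma> c v = edges_at \<Gamma> F v"
proof -
  have v: "v \<in> verts \<Gamma>" using assms by (auto simp: cyclic_set_iff loopless_graph_def)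
  have e: "e \<in> edges_at \<Gamma> c v" and sub: "edges_at \<Gamma> c v \<subseteq> edges_at \<Gamma> F v"
    using assms by (auto simp: edges_at_def)
  then have "card (edges_at \<Gamma> c v) = 2" "card (edges_at \<Gamma> F v) = 2"
    using assms(2,3) v by (auto simp: cyclic_set_iff)
  moreover have "finite (edges_at \<Gamma> F v)" using assms(2) by (auto simp: cyclic_set_iff edges_at_def)
  ultimately show ?thesis using sub by (simp add: card_subset_eq)
qed

lemma circle_in_cyclic_set_is_cycle:
  assumes "loopless_graph \<Gamma>" "cyclic_set \<Gamma> F" "is_circle \<Gamma> c" "c \<subseteq> F"
  shows "is_cycle \<Gamma> c"
proof -
  have c: "c \<subseteq> edges \<Gamma>" "finite c" using assms by (auto simp: cyclic_set_iff intro: finite_subset)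
  have "card (edges_at \<Gamma> c v) = 2" if v: "v \<in> verts \<Gamma>" and e: "e \<in> edges_at \<Gamma> c v" for v e
  proof -
    obtain f where f: "f \<in> c" "f \<noteq> e" "v \<in> ends \<Gamma> f"
      using circle_second_edge[OF assms(1) c(1) assms(3), of e v] e by (auto simp: edges_at_def)
    have sub: "edges_at \<Gamma> c v \<subseteq> edges_at \<Gamma> F v" using assms by (auto simp: edges_at_def)
    have "card (edges_at \<Gamma> F v) = 2" using e sub assms(2) v by (auto simp: cyclic_set_iff)
    moreover have "finite (edges_at \<Gamma> F v)" "finite (edges_at \<Gamma> c v)"
      using assms(2) c by (auto simp: cyclic_set_iff edges_at_def)
    ultimately have le: "card (edges_at \<Gamma> c v) \<le> 2" using sub card_mono by metis
    have "{e, f} \<subseteq> edges_at \<Gamma> c v" using e f by (auto simp: edges_at_def)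
    then have "card {e, f} \<le> card (edges_at \<Gamma> c v)"
      using \<open>finite (edges_at \<Gamma> c v)\<close> by (intro card_mono)
    then show ?thesis using le f by simp
  qed
  then show ?thesis using assms(3) c unfolding is_cycle_def cyclic_set_iff by blast
qed

text \<open>
  Vertices do not repeat, so the length is bounded by the number of vertices and a longest
  path exists.
\<close>

definition edge_path :: "('v, 'e) multigraph \<Rightarrow> 'e set \<Rightarrow> 'v list \<Rightarrow> 'e list \<Rightarrow> bool" where
  "edge_path \<Gamma> F vs es \<longleftrightarrow> length vs = Suc (length es) \<and> distinct vs \<and>
     set vs \<subseteq> verts \<Gamma> \<and> set es \<subseteq> F \<and>
     (\<forall>i<length es. ends \<Gamma> (es ! i) = {vs ! i, vs ! Suc i})"

lemma edge_path_distinct_edges: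
  assumes "edge_path \<Gamma> F vs es"
  shows "distinct es"
proof -
  have "a = b" if "a < length es" "b < length es" "es ! a = es ! b" for a b
  proof -
    have "{vs ! a, vs ! Suc a} = {vs ! b, vs ! Suc b}"
      using assms that unfolding edge_path_def by metis
    then show ?thesis
      using assms that unfolding edge_path_def by (auto simp: doubleton_eq_iff nth_eq_iff_index_eq)
  qed
  then show ?thesis by (auto simp: distinct_conv_nth)
qed

text \<open>
  An edge from the end of a path back to one of its earlier vertices closes the tail of the
  path to a circle. If it leads back to the vertex just before the end, then it is parallel
  to the last edge, and the circle has length two; only the last edge itself must be
  excluded.
\<close>

lemma edge_path_close:
  assumes path: "edge_path \<Gamma> F vs es" and i: "i < length es"
    and f: "ends \<Gamma> f = {last vs, vs ! i}" "f \<noteq> last es"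
  shows "is_circle \<Gamma> (set (drop i es @ [f]))"
proof -
  define n where "n = length es"
  have len: "length vs = Suc n" and dv: "distinct vs" and vs: "set vs \<subseteq> verts \<Gamma>"
    and ends: "\<And>k. k < n \<Longrightarrow> ends \<Gamma> (es ! k) = {vs ! k, vs ! Suc k}"
    using path by (auto simp: edge_path_def n_def)
  have ne: "es \<noteq> []" "vs \<noteq> []" using i len by auto
  have last: "last vs = vs ! n" "last es = es ! (n - 1)"
    using ne len by (auto simp: last_conv_nth n_def)
  have "f \<noteq> es ! k" if k: "k < n" for k
  proof
    assume eq: "f = es ! k"
    then have "vs ! n \<in> {vs ! k, vs ! Suc k}" using ends[OF k] f last by auto
    then have "Suc k = n" using k len dv by (auto simp: nth_eq_iff_index_eq)
    then show False using eq f last by auto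
  qed
  then have "f \<notin> set es" by (auto simp: in_set_conv_nth n_def)
  then have notin: "f \<notin> set (drop i es)" by (meson in_set_dropD)
  have "ends \<Gamma> ((drop i es @ [f]) ! k) =
      {drop i vs ! k, drop i vs ! (Suc k mod length (drop i vs))}"
    if k: "k < length (drop i vs)" for k
  proof (cases "k = n - i")
    case True
    have "Suc k mod length (drop i vs) = 0"
      using True i len by (simp add: n_def Suc_diff_le)
    moreover have "(drop i es @ [f]) ! k = f" using True by (simp add: nth_append n_def)
    moreover have "drop i vs ! k = last vs" "drop i vs ! 0 = vs ! i"
      using True i len last by (simp_all add: n_def)
    ultimately show ?thesis using f by simp
  next
    case False
    then have k: "k < n - i" using k len by (simp add: n_def)
    have "Suc k mod length (drop i vs) = Suc k" using k i len by (simp add: n_def)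
    moreover have "(drop i es @ [f]) ! k = es ! (i + k)"
      using k i by (simp add: nth_append n_def)
    moreover have "drop i vs ! k = vs ! (i + k)" "drop i vs ! Suc k = vs ! Suc (i + k)"
      using k i len by (simp_all add: n_def)
    ultimately show ?thesis using ends[of "i + k"] k by simp
  qed
  moreover have "set (drop i vs) \<subseteq> verts \<Gamma>" using vs set_drop_subset by fast
  ultimately show ?thesis
    unfolding is_circle_def using i len dv notin edge_path_distinct_edges[OF path]
    by (intro exI[of _ "drop i vs"] exI[of _ "drop i es @ [f]"]) (auto simp: n_def)
qed

text \<open>
  At the end of a longest path in \<open>F\<close> there is a second edge of
  \<open>F\<close>, because \<open>F\<close> is two-valent. By maximality this edge returns
  to the path and closes a circle.
\<close>

lemma cyclic_set_contains_cycle: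
  assumes G: "finite_loopless_graph \<Gamma>" and F: "cyclic_set \<Gamma> F" and "F \<noteq> {}"
  obtains c where "is_cycle \<Gamma> c" "c \<subseteq> F"
proof -
  have loopless: "loopless_graph \<Gamma>" and finV: "finite (verts \<Gamma>)"
    using G by (auto simp: finite_loopless_graph_def)
  have FE: "F \<subseteq> edges \<Gamma>" using F by (simp add: cyclic_set_iff)
  define P where "P p \<longleftrightarrow> edge_path \<Gamma> F (fst p) (snd p)" for p :: "'a list \<times> 'b list"
  obtain f0 where f0: "f0 \<in> F" using \<open>F \<noteq> {}\<close> by blast
  then have "card (ends \<Gamma> f0) = 2" "ends \<Gamma> f0 \<subseteq> verts \<Gamma>"
    using loopless FE by (auto simp: loopless_graph_def)
  then obtain u w where "ends \<Gamma> f0 = {u, w}" "u \<noteq> w" "u \<in> verts \<Gamma>" "w \<in> verts \<Gamma>"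
    by (auto simp: card_2_iff)
  then have P0: "P ([u, w], [f0])" using f0 by (auto simp: P_def edge_path_def)
  have bound: "\<forall>p. P p \<longrightarrow> length (snd p) < Suc (card (verts \<Gamma>))"
  proof (intro allI impI)
    fix p assume "P p"
    then have "card (set (fst p)) \<le> card (verts \<Gamma>)" "distinct (fst p)"
      "length (fst p) = Suc (length (snd p))"
      using finV by (auto simp: P_def edge_path_def intro: card_mono)
    then show "length (snd p) < Suc (card (verts \<Gamma>))" by (simp add: distinct_card)
  qed
  obtain p where p: "P p" and max: "\<And>q. P q \<Longrightarrow> length (snd q) \<le> length (snd p)"
    using ex_has_greatest_nat[of P, OF P0 bound] by blast
  obtain vs es where [simp]: "p = (vs, es)" by fastforce
  have path: "edge_path \<Gamma> F vs es" using p by (simp add: P_def)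
  have es: "es \<noteq> []" using max[OF P0] by auto
  have vs: "vs \<noteq> []" using path by (auto simp: edge_path_def)
  have len: "length vs = Suc (length es)" using path by (simp add: edge_path_def)
  have "last es \<in> F" "last vs \<in> ends \<Gamma> (last es)" "last vs \<in> verts \<Gamma>"
    using path es vs len by (auto simp: edge_path_def last_conv_nth)
  then have "last es \<in> edges_at \<Gamma> F (last vs)" "card (edges_at \<Gamma> F (last vs)) = 2"
    using F by (auto simp: edges_at_def cyclic_set_iff)
  then obtain f where "f \<in> edges_at \<Gamma> F (last vs)" and fe: "f \<noteq> last es"
    by (auto simp: card_2_iff)
  then have f: "f \<in> F" "last vs \<in> ends \<Gamma> f" by (auto simp: edges_at_def)
  then have "card (ends \<Gamma> f) = 2" "ends \<Gamma> f \<subseteq> verts \<Gamma>"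
    using loopless FE by (auto simp: loopless_graph_def)
  then obtain w where w: "ends \<Gamma> f = {last vs, w}" "w \<noteq> last vs" "w \<in> verts \<Gamma>"
    using f(2) by (auto simp: card_2_iff insert_commute)
  \<comment> \<open>Otherwise \<open>f\<close> would prolong the path.\<close>
  have "w \<in> set vs"
  proof (rule ccontr)
    assume "w \<notin> set vs"
    then have "P (vs @ [w], es @ [f])"
      using path w f vs len by (auto simp: P_def edge_path_def nth_append last_conv_nth less_Suc_eq)
    from max[OF this] show False by simp
  qed
  then obtain i where i: "i < length vs" "w = vs ! i" by (auto simp: in_set_conv_nth)
  have "i \<noteq> length es" using w i len vs by (auto simp: last_conv_nth)
  then have "is_circle \<Gamma> (set (drop i es @ [f]))"
    using edge_path_close[OF path] i w fe len by auto
  moreover have "set (drop i es @ [f]) \<subseteq> F"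
    using path f set_drop_subset by (fastforce simp: edge_path_def)
  ultimately show ?thesis using that circle_in_cyclic_set_is_cycle[OF loopless F] by blast
qed

text \<open>
  Split off one cycle after the other. A cycle \<open>c\<close> contained in \<open>F\<close>
  uses up both edges of \<open>F\<close> at each of its vertices, so \<open>F - c\<close> is
  again cyclic and shares no vertex with \<open>c\<close>.
\<close>

lemma cyclic_set_decomposition:
  assumes G: "finite_loopless_graph \<Gamma>" and "cyclic_set \<Gamma> F"
  shows "\<exists>S. (\<forall>s\<in>S. is_cycle \<Gamma> s) \<and> pairwise (independent_sets \<Gamma>) S \<and> \<Union>S = F"
proof -
  have loopless: "loopless_graph \<Gamma>" using G by (simp add: finite_loopless_graph_def)
  have "finite F" using assms(2) by (simp add: cyclic_set_iff)
  then show ?thesis using assms(2)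
  proof (induction F rule: finite_psubset_induct)
    case (psubset F)
    show ?case
    proof (cases "F = {}")
      case True
      then show ?thesis by (intro exI[of _ "{}"]) auto
    next
      case False
      then obtain c where c: "is_cycle \<Gamma> c" "c \<subseteq> F"
        using cyclic_set_contains_cycle[OF G psubset.prems] by blast
      have cyc: "cyclic_set \<Gamma> c" using c by (simp add: is_cycle_def)
      have "c \<noteq> {}" using c circle_nonempty by (auto simp: is_cycle_def)
      have at: "edges_at \<Gamma> c v = edges_at \<Gamma> F v" if "e \<in> c" "v \<in> ends \<Gamma> e" for e v
        using edges_at_subcyclic[OF loopless psubset.prems cyc c(2) that] .
      have rest: "edges_at \<Gamma> (F - c) v = {} \<or> edges_at \<Gamma> (F - c) v = edges_at \<Gamma> F v" for v
        using at[of _ v] c(2) unfolding edges_at_def by blast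
      have "edges_at \<Gamma> (F - c) v = {} \<or> card (edges_at \<Gamma> (F - c) v) = 2" if "v \<in> verts \<Gamma>" for v
      proof -
        have "edges_at \<Gamma> F v = {} \<or> card (edges_at \<Gamma> F v) = 2"
          using psubset.prems that by (simp add: cyclic_set_iff)
        then show ?thesis using rest[of v] by presburger
      qed
      then have rest_cyclic: "cyclic_set \<Gamma> (F - c)" using psubset.prems by (auto simp: cyclic_set_iff)
      have "F - c \<subset> F" using c \<open>c \<noteq> {}\<close> by blast
      from psubset.IH[OF this rest_cyclic] obtain S where S: "\<forall>s\<in>S. is_cycle \<Gamma> s" "pairwise (independent_sets \<Gamma>) S" "\<Union>S = F - c"
        by (elim exE conjE)
      have "ends \<Gamma> e \<inter> ends \<Gamma> f = {}" if e: "e \<in> c" and f: "f \<in> F - c" for e f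
      proof (rule ccontr)
        assume "ends \<Gamma> e \<inter> ends \<Gamma> f \<noteq> {}"
        then obtain v where v: "v \<in> ends \<Gamma> e" "v \<in> ends \<Gamma> f" by blast
        then have "f \<in> edges_at \<Gamma> F v" using f by (simp add: edges_at_def)
        then have "f \<in> c" unfolding at[OF e v(1), symmetric] by (simp add: edges_at_def)
        then show False using f by blast
      qed
      then have "independent_sets \<Gamma> c s \<and> independent_sets \<Gamma> s c" if "s \<in> S" for s
        using S(3) that unfolding independent_sets_def by blast
      then have "pairwise (independent_sets \<Gamma>) (insert c S)"
        using S(2) by (auto simp: pairwise_insert)
      then show ?thesis using S c by (intro exI[of _ "insert c S"]) auto
    qed
  qed
qed

lemma independent_family_same_member:
  assumes "pairwise (independent_sets \<Gamma>) S" "s \<in> S" "t \<in> S" "e \<in> s" "f \<in> t"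
    and "v \<in> ends \<Gamma> e" "v \<in> ends \<Gamma> f"
  shows "s = t"
  using assms unfolding pairwise_def independent_sets_def by blast

text \<open>
  If members \<open>s\<close> and \<open>t\<close> of two decompositions share an edge, then
  \<open>s\<close> cannot leave \<open>t\<close>: the next edge of \<open>s\<close> lies in
  some member of the second family that touches \<open>t\<close>, so in \<open>t\<close>
  itself.
\<close>

lemma cyclic_set_decomposition_unique:
  assumes "loopless_graph \<Gamma>"
    and S: "\<forall>s\<in>S. is_cycle \<Gamma> s" "pairwise (independent_sets \<Gamma>) S"
    and T: "\<forall>s\<in>T. is_cycle \<Gamma> s" "pairwise (independent_sets \<Gamma>) T"
    and "\<Union>S = \<Union>T"
  shows "S = T"
proof -
  have sub: "s \<subseteq> t"
    if "is_cycle \<Gamma> s" "s \<subseteq> \<Union>T" "t \<in> T" "e0 \<in> s" "e0 \<in> t" "pairwise (independent_sets \<Gamma>) T" for s t T e0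
  proof
    fix f assume "f \<in> s"
    show "f \<in> t"
    proof (rule circle_induct[OF assms(1), of s e0 "\<lambda>e. e \<in> t" f])
      show "e0 \<in> s" "e0 \<in> t" "f \<in> s" by fact+
    next
      show "s \<subseteq> edges \<Gamma>" "is_circle \<Gamma> s" using that by (auto simp: is_cycle_def cyclic_set_iff)
    next
      fix e f assume "e \<in> s" "f \<in> s" "adjacent_edges \<Gamma> e f" "e \<in> t"
      then show "f \<in> t"
        using independent_family_same_member[OF that(6,3), of _ e f] that(2)
        by (fastforce simp: adjacent_edges_def)
    qed
  qed
  have "S \<subseteq> T" if S: "\<forall>s\<in>S. is_cycle \<Gamma> s" "pairwise (independent_sets \<Gamma>) S"
    and T: "\<forall>s\<in>T. is_cycle \<Gamma> s" "pairwise (independent_sets \<Gamma>) T" and U: "\<Union>S = \<Union>T" for S T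
  proof
    fix s assume s: "s \<in> S"
    then have "s \<noteq> {}" using S circle_nonempty by (auto simp: is_cycle_def)
    then obtain e where e: "e \<in> s" by blast
    then obtain t where t: "t \<in> T" "e \<in> t" using s U by blast
    have "s \<subseteq> t" using sub[of s T t e] S T s t e U by blast
    moreover have "t \<subseteq> s" using sub[of t S s e] S T s t e U by blast
    ultimately show "s \<in> T" using t by simp
  qed
  then show ?thesis using assms by (metis subset_antisym)
qed

section \<open>Cubes of dimer coverings\<close>

text \<open>
  At a vertex on \<open>F\<close>, exactly one of the two edges of \<open>F\<close> belongs
  to \<open>A\<close>. For a dimer covering \<open>A\<close> and a union \<open>F\<close> of
  independent cycles this means that flipping \<open>A\<close> along any of these cycles
  gives a dimer covering again.
\<close>

definition alternates :: "('v, 'e) multigraph \<Rightarrow> 'e set \<Rightarrow> 'e set \<Rightarrow> bool" where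
  "alternates \<Gamma> A F \<longleftrightarrow> (\<forall>v\<in>verts \<Gamma>. edges_at \<Gamma> F v = {} \<or>
     (\<exists>e f. e \<in> A \<and> f \<notin> A \<and> edges_at \<Gamma> F v = {e, f}))"

lemma dimer_coverings_iff:
  "A \<in> dimer_coverings \<Gamma> \<longleftrightarrow> A \<subseteq> edges \<Gamma> \<and> (\<forall>v\<in>verts \<Gamma>. \<exists>e. edges_at \<Gamma> A v = {e})"
proof -
  have "(\<exists>!e. e \<in> A \<and> v \<in> ends \<Gamma> e) \<longleftrightarrow> (\<exists>e. edges_at \<Gamma> A v = {e})" for v
    unfolding edges_at_def Ex1_def by (simp add: set_eq_iff) blast
  then show ?thesis by (simp add: dimer_coverings_def)
qed

lemma cycle_family_cycle:
  assumes "S \<in> cycle_families \<Gamma>" "s \<in> S"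
  shows "is_cycle \<Gamma> s" "cyclic_set \<Gamma> s" "is_circle \<Gamma> s" "even (card s)" "s \<subseteq> edges \<Gamma>"
proof -
  show "is_cycle \<Gamma> s" "even (card s)" using assms by (auto simp: cycle_families_def even_cycle_def)
  then show "cyclic_set \<Gamma> s" "is_circle \<Gamma> s" by (simp_all add: is_cycle_def)
  then show "s \<subseteq> edges \<Gamma>" by (simp add: cyclic_set_def)
qed

lemma cycle_family_independent:
  "S \<in> cycle_families \<Gamma> \<Longrightarrow> pairwise (independent_sets \<Gamma>) S"
  by (simp add: cycle_families_def)

lemma cycle_family_subset:
  "S \<in> cycle_families \<Gamma> \<Longrightarrow> T \<subseteq> S \<Longrightarrow> T \<in> cycle_families \<Gamma>"
  unfolding cycle_families_def by (blast intro: finite_subset pairwise_subset)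

lemma translate_eq:
  assumes "loopless_graph \<Gamma>" "T \<in> cycle_families \<Gamma>"
  shows "translate \<Gamma> T A = (\<Union>T \<union> A) - (\<Union>T \<inter> A)"
  using assms by (simp add: translate_def fprod_eq_Union)

lemma edges_at_cycle_family:
  assumes "pairwise (independent_sets \<Gamma>) S" "s \<in> S" "e \<in> s" "v \<in> ends \<Gamma> e"
  shows "edges_at \<Gamma> (\<Union>S) v = edges_at \<Gamma> s v"
  using independent_family_same_member[OF assms(1,2) _ assms(3) _ assms(4)] assms(2)
  unfolding edges_at_def by blast

lemma edges_at_subfamily:
  assumes S: "pairwise (independent_sets \<Gamma>) S" and "T \<subseteq> S"
  shows "edges_at \<Gamma> (\<Union>T) v = {} \<or> edges_at \<Gamma> (\<Union>T) v = edges_at \<Gamma> (\<Union>S) v"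
proof (cases "edges_at \<Gamma> (\<Union>T) v = {}")
  case False
  then obtain e t where t: "t \<in> T" "e \<in> t" "v \<in> ends \<Gamma> e" by (auto simp: edges_at_def)
  have "pairwise (independent_sets \<Gamma>) T" using S \<open>T \<subseteq> S\<close> by (rule pairwise_subset)
  then have "edges_at \<Gamma> (\<Union>T) v = edges_at \<Gamma> t v" using t by (rule edges_at_cycle_family)
  moreover have "edges_at \<Gamma> (\<Union>S) v = edges_at \<Gamma> t v"
    using edges_at_cycle_family[OF S _ t(2,3)] t \<open>T \<subseteq> S\<close> by blast
  ultimately show ?thesis by simp
qed simp

lemma alternates_subfamily:
  assumes "alternates \<Gamma> A (\<Union>S)" "pairwise (independent_sets \<Gamma>) S" "T \<subseteq> S"
  shows "alternates \<Gamma> A (\<Union>T)"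
  unfolding alternates_def
proof
  fix v assume "v \<in> verts \<Gamma>"
  then show "edges_at \<Gamma> (\<Union>T) v = {} \<or>
      (\<exists>e f. e \<in> A \<and> f \<notin> A \<and> edges_at \<Gamma> (\<Union>T) v = {e, f})"
    using edges_at_subfamily[OF assms(2,3), of v] assms(1) unfolding alternates_def by metis
qed

lemma alternates_adjacent:
  assumes "loopless_graph \<Gamma>" "F \<subseteq> edges \<Gamma>" "alternates \<Gamma> A F"
    and "e \<in> F" "f \<in> F" "adjacent_edges \<Gamma> e f"
  shows "e \<in> A \<longleftrightarrow> f \<notin> A"
proof -
  obtain v where v: "v \<in> ends \<Gamma> e" "v \<in> ends \<Gamma> f" and "e \<noteq> f"
    using assms(6) by (auto simp: adjacent_edges_def)
  have "v \<in> verts \<Gamma>" using v assms by (auto simp: loopless_graph_def)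
  moreover have at: "e \<in> edges_at \<Gamma> F v" "f \<in> edges_at \<Gamma> F v" using v assms by (auto simp: edges_at_def)
  ultimately obtain a b where "a \<in> A" "b \<notin> A" "edges_at \<Gamma> F v = {a, b}"
    using assms(3) unfolding alternates_def by blast
  then show ?thesis using at \<open>e \<noteq> f\<close> by auto
qed

text \<open>
  At a vertex on one of the cycles the flip exchanges the edge of the covering for the other
  edge of that cycle; elsewhere it changes nothing.
\<close>

lemma translate_dimer_covering:
  assumes "loopless_graph \<Gamma>" "A \<in> dimer_coverings \<Gamma>" "T \<in> cycle_families \<Gamma>"
    and "alternates \<Gamma> A (\<Union>T)"
  shows "translate \<Gamma> T A \<in> dimer_coverings \<Gamma>"
  unfolding dimer_coverings_iff
proof (intro conjI ballI)
  have tr: "translate \<Gamma> T A = (\<Union>T \<union> A) - (\<Union>T \<inter> A)" by (rule translate_eq[OF assms(1,3)])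
  have "\<Union>T \<subseteq> edges \<Gamma>" using cycle_family_cycle(5)[OF assms(3)] by blast
  then show "translate \<Gamma> T A \<subseteq> edges \<Gamma>" using assms(2) by (auto simp: tr dimer_coverings_iff)
  fix v assume v: "v \<in> verts \<Gamma>"
  have at: "edges_at \<Gamma> (translate \<Gamma> T A) v =
      (edges_at \<Gamma> (\<Union>T) v \<union> edges_at \<Gamma> A v) - (edges_at \<Gamma> (\<Union>T) v \<inter> edges_at \<Gamma> A v)"
    unfolding tr edges_at_def by blast
  obtain a where a: "edges_at \<Gamma> A v = {a}" using assms(2) v by (auto simp: dimer_coverings_iff)
  consider "edges_at \<Gamma> (\<Union>T) v = {}"
    | e f where "e \<in> A" "f \<notin> A" "edges_at \<Gamma> (\<Union>T) v = {e, f}"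
    using assms(4) v unfolding alternates_def by blast
  then show "\<exists>e. edges_at \<Gamma> (translate \<Gamma> T A) v = {e}"
  proof cases
    case 1
    then show ?thesis using at a by auto
  next
    case (2 e f)
    then have "e \<in> edges_at \<Gamma> A v" by (auto simp: edges_at_def)
    then have "a = e" using a by simp
    then have "edges_at \<Gamma> (translate \<Gamma> T A) v = {f}" using at a 2 by auto
    then show ?thesis by blast
  qed
qed

text \<open>
  Conversely, let \<open>p\<close> and \<open>q\<close> be the two edges of a cycle at a
  vertex and \<open>a\<close> the edge of \<open>A\<close> there. If \<open>a\<close> were
  neither of them, then the flipped set would have the three edges \<open>a\<close>,
  \<open>p\<close>, \<open>q\<close> at this vertex.
\<close>

lemma alternates_if_translate_dimer_covering:
  assumes "loopless_graph \<Gamma>" "A \<in> dimer_coverings \<Gamma>" "S \<in> cycle_families \<Gamma>"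
    and vertices: "\<And>s. s \<in> S \<Longrightarrow> translate \<Gamma> {s} A \<in> dimer_coverings \<Gamma>"
  shows "alternates \<Gamma> A (\<Union>S)"
  unfolding alternates_def
proof (intro ballI disjCI)
  fix v assume v: "v \<in> verts \<Gamma>"
    and no: "\<not> (\<exists>e f. e \<in> A \<and> f \<notin> A \<and> edges_at \<Gamma> (\<Union>S) v = {e, f})"
  show "edges_at \<Gamma> (\<Union>S) v = {}"
  proof (rule ccontr)
    assume "edges_at \<Gamma> (\<Union>S) v \<noteq> {}"
    then obtain e s where s: "s \<in> S" "e \<in> s" "v \<in> ends \<Gamma> e" by (auto simp: edges_at_def)
    have S: "edges_at \<Gamma> (\<Union>S) v = edges_at \<Gamma> s v"
      by (rule edges_at_cycle_family[OF cycle_family_independent[OF assms(3)] s])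
    have "e \<in> edges_at \<Gamma> s v" using s by (simp add: edges_at_def)
    then have "card (edges_at \<Gamma> s v) = 2"
      using cycle_family_cycle(2)[OF assms(3) s(1)] v unfolding cyclic_set_iff by blast
    then obtain p q where pq: "edges_at \<Gamma> s v = {p, q}" "p \<noteq> q" by (auto simp: card_2_iff)
    obtain a where a: "edges_at \<Gamma> A v = {a}" using assms(2) v by (auto simp: dimer_coverings_iff)
    obtain b where b: "edges_at \<Gamma> (translate \<Gamma> {s} A) v = {b}"
      using vertices[OF s(1)] v by (auto simp: dimer_coverings_iff)
    have "{s} \<in> cycle_families \<Gamma>" using cycle_family_subset[OF assms(3)] s(1) by blast
    then have "edges_at \<Gamma> (translate \<Gamma> {s} A) v =
        (edges_at \<Gamma> s v \<union> edges_at \<Gamma> A v) - (edges_at \<Gamma> s v \<inter> edges_at \<Gamma> A v)"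
      unfolding translate_eq[OF assms(1) \<open>{s} \<in> cycle_families \<Gamma>\<close>] edges_at_def by blast
    then have "({p, q} \<union> {a}) - ({p, q} \<inter> {a}) = {b}" using pq a b by simp
    then have "a = p \<or> a = q" using pq(2) by (auto simp: set_eq_iff)
    moreover have "r \<in> A \<longleftrightarrow> r = a" if "r \<in> edges_at \<Gamma> s v" for r
      using that a unfolding edges_at_def by blast
    ultimately show False using no pq S by (metis insert_commute insertI1)
  qed
qed

lemma cube_of_dimer_coverings_iff:
  assumes "loopless_graph \<Gamma>" "S \<in> cycle_families \<Gamma>"
  shows "cube_vertices \<Gamma> (A, S) \<subseteq> dimer_coverings \<Gamma> \<longleftrightarrow>
    A \<in> dimer_coverings \<Gamma> \<and> alternates \<Gamma> A (\<Union>S)"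
proof
  assume *: "cube_vertices \<Gamma> (A, S) \<subseteq> dimer_coverings \<Gamma>"
  then have tr: "translate \<Gamma> T A \<in> dimer_coverings \<Gamma>" if "T \<subseteq> S" for T
    using that by (auto simp: cube_vertices_def)
  have "{} \<in> cycle_families \<Gamma>" by (simp add: cycle_families_def)
  then have "translate \<Gamma> {} A = A" by (simp add: translate_eq[OF assms(1)])
  then have "A \<in> dimer_coverings \<Gamma>" using tr[of "{}"] by simp
  moreover have "alternates \<Gamma> A (\<Union>S)"
    using alternates_if_translate_dimer_covering[OF assms(1) \<open>A \<in> dimer_coverings \<Gamma>\<close> assms(2)] tr
    by simp
  ultimately show "A \<in> dimer_coverings \<Gamma> \<and> alternates \<Gamma> A (\<Union>S)" ..
next
  assume "A \<in> dimer_coverings \<Gamma> \<and> alternates \<Gamma> A (\<Union>S)"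
  then show "cube_vertices \<Gamma> (A, S) \<subseteq> dimer_coverings \<Gamma>"
    using translate_dimer_covering[OF assms(1)] cycle_family_subset[OF assms(2)]
      alternates_subfamily[OF _ cycle_family_independent[OF assms(2)]]
    by (auto simp: cube_vertices_def)
qed

section \<open>Dimer labelings near a vertex\<close>

lemma dimer_labelings_iff:
  "l \<in> dimer_labelings \<Gamma> \<longleftrightarrow> l \<in> edges \<Gamma> \<rightarrow>\<^sub>E {0..} \<and>
     (\<forall>v\<in>verts \<Gamma>. sum l (edges_at \<Gamma> (edges \<Gamma>) v) = 1 \<and>
       card {e \<in> edges_at \<Gamma> (edges \<Gamma>) v. l e \<noteq> 0} \<in> {1, 2})"
  by (simp add: dimer_labelings_def edges_at_def conj_assoc)

text \<open>
  The local shape of a dimer labeling: one label \<open>1\<close>, or two complementary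
  positive labels. The behaviour of a dimer labeling along paths and cycles comes from this
  dichotomy.
\<close>

lemma dimer_labeling_vertex_cases:
  assumes fin: "finite (edges \<Gamma>)" and l: "l \<in> dimer_labelings \<Gamma>" and v: "v \<in> verts \<Gamma>"
  obtains (single) a where "a \<in> edges_at \<Gamma> (edges \<Gamma>) v" "l a = 1"
      "\<And>e. e \<in> edges_at \<Gamma> (edges \<Gamma>) v \<Longrightarrow> e \<noteq> a \<Longrightarrow> l e = 0"
    | (pair) a b where "a \<in> edges_at \<Gamma> (edges \<Gamma>) v" "b \<in> edges_at \<Gamma> (edges \<Gamma>) v" "a \<noteq> b"
      "0 < l a" "0 < l b" "l a + l b = 1"
      "\<And>e. e \<in> edges_at \<Gamma> (edges \<Gamma>) v \<Longrightarrow> e \<noteq> a \<Longrightarrow> e \<noteq> b \<Longrightarrow> l e = 0"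
proof -
  define N where "N = edges_at \<Gamma> (edges \<Gamma>) v"
  define M where "M = {e \<in> N. l e \<noteq> 0}"
  have nonneg: "0 \<le> l e" if "e \<in> N" for e
    using l that by (auto simp: N_def edges_at_def dimer_labelings_iff)
  have "finite N" using fin by (simp add: N_def edges_at_def)
  then have "sum l N = sum l M" by (intro sum.mono_neutral_right) (auto simp: M_def)
  then have sum: "sum l M = 1" and card: "card M = 1 \<or> card M = 2"
    using l v by (auto simp: dimer_labelings_iff N_def M_def)
  have zero: "l e = 0" if "e \<in> N" "e \<notin> M" for e using that by (auto simp: M_def)
  from card show ?thesis
  proof
    assume "card M = 1"
    then obtain a where a: "M = {a}" by (auto simp: card_1_singleton_iff)
    then have "a \<in> N" by (auto simp: M_def)
    then show ?thesis using that(1)[of a] sum zero a by (simp add: N_def)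
  next
    assume "card M = 2"
    then obtain a b where a: "M = {a, b}" "a \<noteq> b" by (auto simp: card_2_iff)
    then have "a \<in> M" "b \<in> M" by auto
    then have "a \<in> N" "b \<in> N" "0 < l a" "0 < l b" using nonneg by (force simp: M_def)+
    then show ?thesis using that(2)[of a b] sum zero a by (simp add: N_def)
  qed
qed

lemma sum_label_single:
  fixes l :: "'e \<Rightarrow> real"
  assumes "finite N" "a \<in> N" "l a = 1" "\<And>e. e \<in> N \<Longrightarrow> e \<noteq> a \<Longrightarrow> l e = 0"
  shows "sum l N = 1 \<and> card {e \<in> N. l e \<noteq> 0} \<in> {1, 2}"
proof -
  have "{e \<in> N. l e \<noteq> 0} = {a}" using assms by auto
  moreover have "sum l N = sum l {a}"
    using assms by (intro sum.mono_neutral_right) auto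
  ultimately show ?thesis using assms by simp
qed

text \<open>
  One of the two labels may vanish here, which covers the boundary points of a cube and the
  ends of a segment.
\<close>

lemma sum_label_pair:
  fixes l :: "'e \<Rightarrow> real"
  assumes "finite N" "a \<in> N" "b \<in> N" "a \<noteq> b" "l a + l b = 1"
    and "\<And>e. e \<in> N \<Longrightarrow> e \<noteq> a \<Longrightarrow> e \<noteq> b \<Longrightarrow> l e = 0"
  shows "sum l N = 1 \<and> card {e \<in> N. l e \<noteq> 0} \<in> {1, 2}"
proof -
  have sub: "{e \<in> N. l e \<noteq> 0} \<subseteq> {a, b}" using assms(6) by blast
  then have "card {e \<in> N. l e \<noteq> 0} \<le> card {a, b}" by (intro card_mono) auto
  moreover have "{e \<in> N. l e \<noteq> 0} \<noteq> {}" using assms(2,3,5) by force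
  then have "card {e \<in> N. l e \<noteq> 0} \<noteq> 0" using finite_subset[OF sub] by (simp add: card_0_eq)
  moreover have "sum l N = sum l {a, b}"
    using assms by (intro sum.mono_neutral_right) auto
  ultimately show ?thesis using assms(4,5) by auto
qed

lemma adjacent_labels:
  assumes "loopless_graph \<Gamma>" "finite (edges \<Gamma>)" "l \<in> dimer_labelings \<Gamma>"
    and "e \<in> edges \<Gamma>" "f \<in> edges \<Gamma>" "adjacent_edges \<Gamma> e f" "0 < l e" "0 < l f"
  shows "l e + l f = 1"
proof -
  obtain v where v: "v \<in> ends \<Gamma> e" "v \<in> ends \<Gamma> f" and ne: "e \<noteq> f"
    using assms(6) by (auto simp: adjacent_edges_def)
  have "v \<in> verts \<Gamma>" using v assms by (auto simp: loopless_graph_def)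
  have at: "e \<in> edges_at \<Gamma> (edges \<Gamma>) v" "f \<in> edges_at \<Gamma> (edges \<Gamma>) v"
    using v assms by (auto simp: edges_at_def)
  from assms(2,3) \<open>v \<in> verts \<Gamma>\<close> show ?thesis
  proof (cases rule: dimer_labeling_vertex_cases)
    case (single a)
    then show ?thesis using at ne assms(7,8) by (metis less_irrefl)
  next
    case (pair a b)
    then have "e = a \<or> e = b" "f = a \<or> f = b" using at assms(7,8) by (metis less_irrefl)+
    then show ?thesis using pair(6) ne by auto
  qed
qed

text \<open>
  This rigidity of odd cycles is what separates the image of the evaluation map from the
  remaining dimer labelings: positivity on \<open>c\<close>, an open condition, is equivalent
  to the closed condition that all labels on \<open>c\<close> are \<open>1/2\<close>.
\<close>

lemma odd_cycle_labels:
  assumes "loopless_graph \<Gamma>" "finite (edges \<Gamma>)" "l \<in> dimer_labelings \<Gamma>"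
    and c: "is_cycle \<Gamma> c" "odd (card c)" and pos: "\<And>e. e \<in> c \<Longrightarrow> 0 < l e" and "f \<in> c"
  shows "l f = 1 / 2"
proof -
  have "c \<subseteq> edges \<Gamma>" "is_circle \<Gamma> c" using c by (auto simp: is_cycle_def cyclic_set_iff)
  then show ?thesis
    using alternating_on_odd_circle[OF assms(1), of c l f] adjacent_labels[OF assms(1-3)] c(2) pos \<open>f \<in> c\<close>
    by blast
qed

lemma fractional_edges_cyclic:
  assumes "loopless_graph \<Gamma>" "finite (edges \<Gamma>)" "l \<in> dimer_labelings \<Gamma>"
  shows "cyclic_set \<Gamma> {e \<in> edges \<Gamma>. 0 < l e \<and> l e < 1}"
  unfolding cyclic_set_iff
proof (intro conjI ballI)
  fix v assume "v \<in> verts \<Gamma>"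
  let ?F = "{e \<in> edges \<Gamma>. 0 < l e \<and> l e < 1}"
  from assms(2,3) \<open>v \<in> verts \<Gamma>\<close>
  show "edges_at \<Gamma> ?F v = {} \<or> card (edges_at \<Gamma> ?F v) = 2"
  proof (cases rule: dimer_labeling_vertex_cases)
    case (single a)
    then have "edges_at \<Gamma> ?F v = {}" by (force simp: edges_at_def)
    then show ?thesis ..
  next
    case (pair a b)
    then have "edges_at \<Gamma> ?F v = {a, b}" by (force simp: edges_at_def)
    then show ?thesis using pair by simp
  qed
qed (use assms in auto)

section \<open>The image of the evaluation map\<close>

text \<open>
  The triples on those based cubes all of whose vertices are dimer coverings; by
  \<open>cube_of_dimer_coverings_iff\<close>, alternation expresses this at the base vertex
  alone.
\<close>

definition dimer_triples :: "('v, 'e) multigraph \<Rightarrow> 'e triple set" where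
  "dimer_triples \<Gamma> = {((A, S), x) |A S x. A \<in> dimer_coverings \<Gamma> \<and> S \<in> cycle_families \<Gamma> \<and>
     alternates \<Gamma> A (\<Union>S) \<and> x \<in> S \<rightarrow>\<^sub>E {0..1}}"

lemma dimer_triples_iff:
  "((A, S), x) \<in> dimer_triples \<Gamma> \<longleftrightarrow> A \<in> dimer_coverings \<Gamma> \<and> S \<in> cycle_families \<Gamma> \<and>
     alternates \<Gamma> A (\<Union>S) \<and> x \<in> S \<rightarrow>\<^sub>E {0..1}"
  by (simp add: dimer_triples_def)

lemma dimer_triples_subset: "dimer_triples \<Gamma> \<subseteq> topspace (triple_space \<Gamma>)"
proof
  fix p :: "'a triple" assume "p \<in> dimer_triples \<Gamma>"
  then show "p \<in> topspace (triple_space \<Gamma>)"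
    by (cases p, cases "fst p") (auto simp: dimer_triples_iff triple_in_topspace_iff dimer_coverings_iff)
qed

text \<open>
  If there is a dimer covering, this set turns out to be the component
  \<open>L\<^sub>0(\<Gamma>)\<close>. Odd cycles are allowed in the graph; they only may not
  carry positive labels on all their edges.
\<close>

definition odd_cycle_free_labelings :: "('v, 'e) multigraph \<Rightarrow> ('e \<Rightarrow> real) set" where
  "odd_cycle_free_labelings \<Gamma> =
     {l \<in> dimer_labelings \<Gamma>. \<forall>c. is_cycle \<Gamma> c \<and> odd (card c) \<longrightarrow> (\<exists>e\<in>c. l e \<le> 0)}"

lemma eval_triple_cycle:
  assumes "loopless_graph \<Gamma>" "S \<in> cycle_families \<Gamma>" "s \<in> S" "e \<in> s"
  shows "eval_triple \<Gamma> ((A, S), x) e = (if e \<in> A then 1 - x s else x s)"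
  using eval_triple_in[OF assms] cycle_family_cycle(5)[OF assms(2,3)] assms(4) by blast

lemma eval_triple_unit_interval:
  assumes "loopless_graph \<Gamma>" "p \<in> topspace (triple_space \<Gamma>)"
  shows "eval_triple \<Gamma> p \<in> edges \<Gamma> \<rightarrow>\<^sub>E {0..1}"
proof -
  obtain A S x where p: "p = ((A, S), x)" by (metis surj_pair)
  then have S: "S \<in> cycle_families \<Gamma>" and x: "x \<in> S \<rightarrow>\<^sub>E {0..1}"
    using assms(2) by (auto simp: triple_in_topspace_iff)
  have "eval_triple \<Gamma> p e \<in> {0..1}" if e: "e \<in> edges \<Gamma>" for e
  proof (cases "e \<in> \<Union>S")
    case True
    then obtain s where s: "s \<in> S" "e \<in> s" by blast
    then have "x s \<in> {0..1}" using x by blast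
    then show ?thesis using eval_triple_cycle[OF assms(1) S s] p by simp
  next
    case False
    then show ?thesis using eval_triple_notin[OF False e] p by (simp add: indicator_def)
  qed
  moreover have "eval_triple \<Gamma> p e = undefined" if "e \<notin> edges \<Gamma>" for e
    using that p by (simp add: eval_triple_def)
  ultimately show ?thesis by (auto simp: PiE_iff extensional_def)
qed

text \<open>
  At a vertex on a cycle \<open>s\<close> of the cube, the edge of \<open>A\<close> is one of
  the two edges of \<open>s\<close>, so that these have the labels \<open>1 - x s\<close> and
  \<open>x s\<close>, and all other labels vanish. At any other vertex the labeling is that
  of \<open>A\<close>.
\<close>

lemma eval_dimer_triple_labeling:
  assumes G: "finite_loopless_graph \<Gamma>" and p: "((A, S), x) \<in> dimer_triples \<Gamma>"
  shows "eval_triple \<Gamma> ((A, S), x) \<in> dimer_labelings \<Gamma>"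
  unfolding dimer_labelings_iff
proof (intro conjI[of "_ \<in> _"] ballI)
  let ?l = "eval_triple \<Gamma> ((A, S), x)"
  have loopless: "loopless_graph \<Gamma>" and fin: "finite (edges \<Gamma>)"
    using G by (auto simp: finite_loopless_graph_def)
  have A: "A \<in> dimer_coverings \<Gamma>" and S: "S \<in> cycle_families \<Gamma>"
    and alt: "alternates \<Gamma> A (\<Union>S)" and x: "x \<in> S \<rightarrow>\<^sub>E {0..1}"
    using p by (auto simp: dimer_triples_iff)
  show "?l \<in> edges \<Gamma> \<rightarrow>\<^sub>E {0..}"
    using eval_triple_unit_interval[OF loopless subsetD[OF dimer_triples_subset p]]
    unfolding PiE_iff by simp
  fix v assume v: "v \<in> verts \<Gamma>"
  let ?N = "edges_at \<Gamma> (edges \<Gamma>) v"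
  have N: "finite ?N" using fin by (simp add: edges_at_def)
  obtain a where a: "edges_at \<Gamma> A v = {a}" using A v by (auto simp: dimer_coverings_iff)
  have aA: "a \<in> A" using a by (auto simp: edges_at_def)
  have aN: "a \<in> ?N" using a A unfolding dimer_coverings_iff edges_at_def by blast
  have notA: "e \<notin> A" if "e \<in> ?N" "e \<noteq> a" for e using a that unfolding edges_at_def by blast
  have notS: "e \<notin> \<Union>S" if "e \<in> ?N" "e \<notin> edges_at \<Gamma> (\<Union>S) v" for e
    using that unfolding edges_at_def by blast
  have ind: "?l e = indicator A e" if "e \<in> ?N" "e \<notin> edges_at \<Gamma> (\<Union>S) v" for e
    using eval_triple_notin[OF notS[OF that], of \<Gamma> A x] that(1) unfolding edges_at_def by blast
  consider "edges_at \<Gamma> (\<Union>S) v = {}"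
    | e f where "e \<in> A" "f \<notin> A" "edges_at \<Gamma> (\<Union>S) v = {e, f}"
    using alt v unfolding alternates_def by blast
  then show "sum ?l ?N = 1 \<and> card {e \<in> ?N. ?l e \<noteq> 0} \<in> {1, 2}"
  proof cases
    case 1
    then show ?thesis using sum_label_single[OF N aN, of ?l] ind aA aN notA by auto
  next
    case (2 e f)
    have "e \<in> edges_at \<Gamma> A v" using 2 by (auto simp: edges_at_def)
    then have [simp]: "e = a" using a by simp
    have "a \<in> edges_at \<Gamma> (\<Union>S) v" "f \<in> edges_at \<Gamma> (\<Union>S) v" using 2 by simp_all
    then have mem: "a \<in> \<Union>S" "f \<in> \<Union>S" "v \<in> ends \<Gamma> a" "v \<in> ends \<Gamma> f"
      by (simp_all add: edges_at_def)
    obtain s where s: "s \<in> S" "a \<in> s" using mem(1) by (rule UnionE)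
    obtain t where t: "t \<in> S" "f \<in> t" using mem(2) by (rule UnionE)
    have "s = t"
      by (rule independent_family_same_member[OF cycle_family_independent[OF S] s(1) t(1) s(2) t(2) mem(3,4)])
    then have f: "f \<in> s" using t by simp
    have "?l a = 1 - x s" "?l f = x s"
      using eval_triple_cycle[OF loopless S s] eval_triple_cycle[OF loopless S s(1) f] 2 by simp_all
    moreover have "f \<in> ?N"
      using mem(4) f cycle_family_cycle(5)[OF S s(1)] by (auto simp: edges_at_def)
    moreover have "a \<noteq> f" using 2 by auto
    ultimately show ?thesis using sum_label_pair[OF N aN, of f ?l] ind notA 2 by simp
  qed
qed

text \<open>
  On an odd cycle with positive labels, the labels would be \<open>1/2\<close>. Such labels
  occur only on the cycles of the cube, where \<open>A\<close> alternates; but no set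
  alternates along an odd cycle.
\<close>

lemma eval_dimer_triple_odd_cycle_free:
  assumes G: "finite_loopless_graph \<Gamma>" and p: "((A, S), x) \<in> dimer_triples \<Gamma>"
  shows "eval_triple \<Gamma> ((A, S), x) \<in> odd_cycle_free_labelings \<Gamma>"
proof -
  let ?l = "eval_triple \<Gamma> ((A, S), x)"
  have loopless: "loopless_graph \<Gamma>" and fin: "finite (edges \<Gamma>)"
    using G by (auto simp: finite_loopless_graph_def)
  have S: "S \<in> cycle_families \<Gamma>" and alt: "alternates \<Gamma> A (\<Union>S)"
    using p by (auto simp: dimer_triples_iff)
  have l: "?l \<in> dimer_labelings \<Gamma>" by (rule eval_dimer_triple_labeling[OF assms])
  have False if c: "is_cycle \<Gamma> c" "odd (card c)" and pos: "\<And>e. e \<in> c \<Longrightarrow> 0 < ?l e" for c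
  proof -
    have circ: "c \<subseteq> edges \<Gamma>" "is_circle \<Gamma> c" using c by (auto simp: is_cycle_def cyclic_set_iff)
    have half: "?l e = 1 / 2" if "e \<in> c" for e
      using odd_cycle_labels[OF loopless fin l c pos that] .
    have sub: "e \<in> \<Union>S" if "e \<in> c" for e
    proof (rule ccontr)
      assume "e \<notin> \<Union>S"
      moreover have "e \<in> edges \<Gamma>" using circ that by blast
      ultimately have "?l e = indicator A e" by (rule eval_triple_notin)
      then show False using half[OF that] by (cases "e \<in> A") simp_all
    qed
    have SE: "\<Union>S \<subseteq> edges \<Gamma>" using cycle_family_cycle(5)[OF S] by blast
    obtain e where "e \<in> c" using circle_nonempty[OF circ(2)] by blast
    have "indicator A f + indicator A g = (1 :: real)"
      if "f \<in> c" "g \<in> c" "adjacent_edges \<Gamma> f g" for f g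
      using alternates_adjacent[OF loopless SE alt sub[OF that(1)] sub[OF that(2)] that(3)]
      by (cases "f \<in> A") simp_all
    then have "indicator A e = (1 / 2 :: real)"
      by (rule alternating_on_odd_circle[OF loopless circ c(2) _ \<open>e \<in> c\<close>])
    then show False by (cases "e \<in> A") simp_all
  qed
  then show ?thesis using l unfolding odd_cycle_free_labelings_def by (force simp: not_le)
qed

lemma even_cycle_labels:
  assumes "loopless_graph \<Gamma>" "finite (edges \<Gamma>)" "l \<in> dimer_labelings \<Gamma>"
    and c: "is_cycle \<Gamma> c" "even (card c)" and pos: "\<And>e. e \<in> c \<Longrightarrow> 0 < l e"
  shows "\<exists>B a. B \<subseteq> c \<and> (\<forall>e\<in>c. \<forall>f\<in>c. adjacent_edges \<Gamma> e f \<longrightarrow> (e \<in> B \<longleftrightarrow> f \<notin> B)) \<and>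
    (\<forall>e\<in>c. l e = (if e \<in> B then 1 - a else a))"
proof -
  have circ: "c \<subseteq> edges \<Gamma>" "is_circle \<Gamma> c" using c by (auto simp: is_cycle_def cyclic_set_iff)
  obtain B where B: "B \<subseteq> c" "\<forall>e\<in>c. \<forall>f\<in>c. adjacent_edges \<Gamma> e f \<longrightarrow> (e \<in> B \<longleftrightarrow> f \<notin> B)"
    using even_circle_alternating_half[OF assms(1) circ c(2)] by blast
  have "l e + l f = 1" if "e \<in> c" "f \<in> c" "adjacent_edges \<Gamma> e f" for e f
    using adjacent_labels[OF assms(1-3)] that circ pos by blast
  then obtain a where "\<forall>e\<in>c. l e = (if e \<in> B then 1 - a else a)"
    using alternating_on_even_circle[OF assms(1) circ, of B l] B by blast
  then show ?thesis using B by blast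
qed

text \<open>
  The cube is read off from the labeling \<open>l\<close>. Its cycles are those of the set
  \<open>F\<close> of edges with a label strictly between \<open>0\<close> and
  \<open>1\<close>; they are even by hypothesis. Its base vertex \<open>A\<close> consists of
  the edges with label \<open>1\<close> and of every other edge of each cycle.
\<close>

lemma odd_cycle_free_labeling_in_image:
  assumes G: "finite_loopless_graph \<Gamma>" and l: "l \<in> odd_cycle_free_labelings \<Gamma>"
  shows "l \<in> eval_triple \<Gamma> ` dimer_triples \<Gamma>"
proof -
  have loopless: "loopless_graph \<Gamma>" and fin: "finite (edges \<Gamma>)"
    using G by (auto simp: finite_loopless_graph_def)
  have L: "l \<in> dimer_labelings \<Gamma>"
    and no_odd: "\<And>c. is_cycle \<Gamma> c \<Longrightarrow> (\<And>e. e \<in> c \<Longrightarrow> 0 < l e) \<Longrightarrow> even (card c)"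
    using l unfolding odd_cycle_free_labelings_def by (auto simp: not_le) (metis not_le)
  have lE: "l \<in> edges \<Gamma> \<rightarrow>\<^sub>E {0..1}" using dimer_labelings_subset_cube[OF G] L by auto
  define F where "F = {e \<in> edges \<Gamma>. 0 < l e \<and> l e < 1}"
  have "cyclic_set \<Gamma> F" unfolding F_def by (rule fractional_edges_cyclic[OF loopless fin L])
  then obtain S where S: "\<forall>s\<in>S. is_cycle \<Gamma> s" "pairwise (independent_sets \<Gamma>) S" "\<Union>S = F"
    using cyclic_set_decomposition[OF G] by blast
  have F: "e \<in> edges \<Gamma>" "0 < l e" "l e < 1" if "s \<in> S" "e \<in> s" for s e
    using that S(3) unfolding F_def by blast+
  have "finite F" using fin by (simp add: F_def)
  then have "finite S" using S(3) by (simp add: finite_UnionD)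
  moreover have even: "even (card s)" if "s \<in> S" for s
    using no_odd S(1) F(2) that by blast
  ultimately have fam: "S \<in> cycle_families \<Gamma>"
    using S by (simp add: cycle_families_def even_cycle_def)
  have disj: "s = t" if "s \<in> S" "t \<in> S" "e \<in> s" "e \<in> t" for s t e
    using cycle_families_disjoint[OF loopless fam that] .
  have "\<forall>s\<in>S. \<exists>B a. B \<subseteq> s \<and> (\<forall>e\<in>s. \<forall>f\<in>s. adjacent_edges \<Gamma> e f \<longrightarrow> (e \<in> B \<longleftrightarrow> f \<notin> B)) \<and>
      (\<forall>e\<in>s. l e = (if e \<in> B then 1 - a else a))"
    using even_cycle_labels[OF loopless fin L bspec[OF S(1)] even F(2)] by simp
  from bchoice[OF this] obtain B where "\<forall>s\<in>S. \<exists>a. B s \<subseteq> s \<and>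
      (\<forall>e\<in>s. \<forall>f\<in>s. adjacent_edges \<Gamma> e f \<longrightarrow> (e \<in> B s \<longleftrightarrow> f \<notin> B s)) \<and>
      (\<forall>e\<in>s. l e = (if e \<in> B s then 1 - a else a))" ..
  from bchoice[OF this] obtain x where Bx: "\<forall>s\<in>S. B s \<subseteq> s \<and>
      (\<forall>e\<in>s. \<forall>f\<in>s. adjacent_edges \<Gamma> e f \<longrightarrow> (e \<in> B s \<longleftrightarrow> f \<notin> B s)) \<and>
      (\<forall>e\<in>s. l e = (if e \<in> B s then 1 - x s else x s))" ..
  have B: "B s \<subseteq> s" if "s \<in> S" for s using Bx that by simp
  have B_alt: "e \<in> B s \<longleftrightarrow> f \<notin> B s"
    if "s \<in> S" "e \<in> s" "f \<in> s" "adjacent_edges \<Gamma> e f" for s e f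
    using Bx that by simp
  have x: "l e = (if e \<in> B s then 1 - x s else x s)" if "s \<in> S" "e \<in> s" for s e
    using Bx that by simp
  define A where "A = {e \<in> edges \<Gamma>. l e = 1} \<union> (\<Union>s\<in>S. B s)"
  have A_cycle: "e \<in> A \<longleftrightarrow> e \<in> B s" if s: "s \<in> S" "e \<in> s" for s e
  proof
    assume "e \<in> A"
    then obtain t where t: "t \<in> S" "e \<in> B t" using F(3)[OF s] by (auto simp: A_def)
    then have "e \<in> t" using B by blast
    then show "e \<in> B s" using disj[OF s(1) t(1) s(2)] t(2) by simp
  next
    assume "e \<in> B s"
    then show "e \<in> A" using s(1) by (auto simp: A_def)
  qed
  have B_F: "e \<in> F" if "s \<in> S" "e \<in> B s" for s e using B that S(3) by blast
  have A_sub: "A \<subseteq> edges \<Gamma>" using B_F by (auto simp: A_def F_def)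
  have A_rest: "e \<in> A \<longleftrightarrow> l e = 1" if "e \<in> edges \<Gamma>" "e \<notin> F" for e
    using that B_F by (auto simp: A_def)
  have A_pos: "0 < l e" if "e \<in> A" for e
    using that B_F by (auto simp: A_def F_def)
  have at: "(\<exists>e. edges_at \<Gamma> A v = {e}) \<and>
      (edges_at \<Gamma> F v = {} \<or> (\<exists>e f. e \<in> A \<and> f \<notin> A \<and> edges_at \<Gamma> F v = {e, f}))"
    if v: "v \<in> verts \<Gamma>" for v
    using fin L v
  proof (cases rule: dimer_labeling_vertex_cases)
    case (single a)
    have "edges_at \<Gamma> F v = {}" using single unfolding F_def edges_at_def by force
    moreover have "a \<in> A" using single by (simp add: A_def edges_at_def)
    then have "edges_at \<Gamma> A v = {a}"
      using single A_sub A_pos unfolding edges_at_def by fastforce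
    ultimately show ?thesis by blast
  next
    case (pair a b)
    have FE: "edges_at \<Gamma> F v = {a, b}" using pair unfolding F_def edges_at_def by force
    then have ab: "a \<in> F" "b \<in> F" "v \<in> ends \<Gamma> a" "v \<in> ends \<Gamma> b" unfolding edges_at_def by blast+
    obtain s where s: "s \<in> S" "a \<in> s" using ab S(3) by blast
    obtain t where t: "t \<in> S" "b \<in> t" using ab S(3) by blast
    have "s = t" using independent_family_same_member[OF S(2) s(1) t(1) s(2) t(2) ab(3,4)] .
    then have "b \<in> s" using t by simp
    have "adjacent_edges \<Gamma> a b" using pair(3) ab unfolding adjacent_edges_def by blast
    then have alt: "a \<in> A \<longleftrightarrow> b \<notin> A"
      using B_alt[OF s \<open>b \<in> s\<close>] A_cycle[OF s] A_cycle[OF s(1) \<open>b \<in> s\<close>] by blast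
    have "edges_at \<Gamma> A v \<subseteq> {a, b}"
      using pair(7) A_sub A_pos unfolding edges_at_def by fastforce
    moreover have "e \<in> edges_at \<Gamma> A v \<longleftrightarrow> e \<in> A" if "e = a \<or> e = b" for e
      using that ab by (auto simp: edges_at_def)
    ultimately have "edges_at \<Gamma> A v = (if a \<in> A then {a} else {b})"
      using alt by auto
    moreover have "\<exists>e f. e \<in> A \<and> f \<notin> A \<and> edges_at \<Gamma> F v = {e, f}"
      using alt FE by (metis insert_commute)
    ultimately show ?thesis by auto
  qed
  then have "A \<in> dimer_coverings \<Gamma>" "alternates \<Gamma> A (\<Union>S)"
    using A_sub unfolding dimer_coverings_iff alternates_def S(3) by simp_all
  moreover have "restrict x S \<in> S \<rightarrow>\<^sub>E {0..1}"
  proof -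
    have "x s \<in> {0..1}" if "s \<in> S" for s
    proof -
      obtain e where e: "e \<in> s"
        using circle_nonempty[OF cycle_family_cycle(3)[OF fam \<open>s \<in> S\<close>]] by blast
      show ?thesis using x[OF that e] F[OF that e] by (auto split: if_splits)
    qed
    then show ?thesis by auto
  qed
  ultimately have "((A, S), restrict x S) \<in> dimer_triples \<Gamma>"
    using fam by (simp add: dimer_triples_iff)
  moreover have "eval_triple \<Gamma> ((A, S), restrict x S) e = l e" for e
  proof (cases "e \<in> F")
    case True
    then obtain s where s: "s \<in> S" "e \<in> s" using S(3) by blast
    then show ?thesis
      using eval_triple_cycle[OF loopless fam s] A_cycle[OF s] x[OF s] by simp
  next
    case False
    show ?thesis
    proof (cases "e \<in> edges \<Gamma>")
      case True
      have "l e \<in> {0..1}" using lE True by (rule PiE_mem)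
      then have "l e = 0 \<or> l e = 1" using True False by (auto simp: F_def)
      then show ?thesis
        using eval_triple_notin[of e S, OF _ True] A_rest[OF True False] False S(3) by (auto simp: indicator_def)
    next
      case no: False
      then show ?thesis using lE by (auto simp: eval_triple_def PiE_iff extensional_def)
    qed
  qed
  ultimately show ?thesis by (metis ext rev_image_eqI)
qed

lemma eval_image_dimer_triples:
  assumes "finite_loopless_graph \<Gamma>"
  shows "eval_triple \<Gamma> ` dimer_triples \<Gamma> = odd_cycle_free_labelings \<Gamma>"
proof
  show "eval_triple \<Gamma> ` dimer_triples \<Gamma> \<subseteq> odd_cycle_free_labelings \<Gamma>"
    using eval_dimer_triple_odd_cycle_free[OF assms] by (auto simp: dimer_triples_def)
  show "odd_cycle_free_labelings \<Gamma> \<subseteq> eval_triple \<Gamma> ` dimer_triples \<Gamma>"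
    using odd_cycle_free_labeling_in_image[OF assms] by blast
qed

section \<open>Injectivity\<close>

lemma alternates_cong:
  assumes "alternates \<Gamma> A F" "\<And>e. e \<in> F \<Longrightarrow> e \<in> A \<longleftrightarrow> e \<in> A'"
  shows "alternates \<Gamma> A' F"
  unfolding alternates_def
proof
  fix v assume "v \<in> verts \<Gamma>"
  then consider "edges_at \<Gamma> F v = {}"
    | e f where "e \<in> A" "f \<notin> A" "edges_at \<Gamma> F v = {e, f}"
    using assms(1) unfolding alternates_def by blast
  then show "edges_at \<Gamma> F v = {} \<or> (\<exists>e f. e \<in> A' \<and> f \<notin> A' \<and> edges_at \<Gamma> F v = {e, f})"
  proof cases
    case (2 e f)
    then have "e \<in> F" "f \<in> F" unfolding edges_at_def by blast+
    then show ?thesis using 2 assms(2) by blast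
  qed blast
qed

text \<open>
  Every point of a cube lies in the interior of a face: rebasing turns the coordinates
  \<open>1\<close> into \<open>0\<close>, and the cycles with coordinate \<open>0\<close> can
  then be dropped.
\<close>

lemma interior_representative:
  assumes loopless: "loopless_graph \<Gamma>" and p: "((A, S), x) \<in> dimer_triples \<Gamma>"
  obtains A' S' x' where "((A', S'), x') \<in> dimer_triples \<Gamma>" "\<And>s. s \<in> S' \<Longrightarrow> 0 < x' s \<and> x' s < 1"
    "equivclp (glue \<Gamma>) ((A, S), x) ((A', S'), x')"
proof -
  have A: "A \<in> dimer_coverings \<Gamma>" and S: "S \<in> cycle_families \<Gamma>"
    and alt: "alternates \<Gamma> A (\<Union>S)" and x: "x \<in> S \<rightarrow>\<^sub>E {0..1}"
    using p by (auto simp: dimer_triples_iff)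
  have ind: "pairwise (independent_sets \<Gamma>) S" by (rule cycle_family_independent[OF S])
  define T where "T = {s \<in> S. x s = 1}"
  define S' where "S' = {s \<in> S. x s \<noteq> 0 \<and> x s \<noteq> 1}"
  define A' where "A' = translate \<Gamma> T A"
  define y where "y = (\<lambda>s\<in>S. if s \<in> T then 0 else x s)"
  have sub: "T \<subseteq> S" "S' \<subseteq> S" by (auto simp: T_def S'_def)
  have fam: "T \<in> cycle_families \<Gamma>" "S' \<in> cycle_families \<Gamma>" using cycle_family_subset[OF S] sub by auto
  have A': "A' \<in> dimer_coverings \<Gamma>"
    unfolding A'_def using translate_dimer_covering[OF loopless A fam(1)] alternates_subfamily[OF alt ind sub(1)]
    by blast
  have x01: "0 \<le> x s \<and> x s \<le> 1" if "s \<in> S" for s using x that by (auto simp: PiE_iff)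
  have y: "y \<in> S \<rightarrow>\<^sub>E {0..1}" using x01 by (auto simp: y_def)
  have y': "restrict y S' \<in> S' \<rightarrow>\<^sub>E {0..1}" using y sub by (auto simp: PiE_iff)
  have disj: "e \<notin> \<Union>T" if "e \<in> \<Union>S'" for e
  proof
    assume "e \<in> \<Union>T"
    then obtain s t where st: "s \<in> S'" "t \<in> T" "e \<in> s" "e \<in> t" using \<open>e \<in> \<Union>S'\<close> by blast
    then have "s = t" using cycle_families_disjoint[OF loopless S, of s t e] sub by blast
    then show False using st by (auto simp: T_def S'_def)
  qed
  have "alternates \<Gamma> A' (\<Union>S')"
  proof (rule alternates_cong[OF alternates_subfamily[OF alt ind sub(2)]])
    fix e assume "e \<in> \<Union>S'"
    from disj[OF this] show "e \<in> A \<longleftrightarrow> e \<in> A'"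
      unfolding A'_def translate_eq[OF loopless fam(1)] by simp
  qed
  then have q: "((A', S'), restrict y S') \<in> dimer_triples \<Gamma>"
    using A' fam y' by (simp add: dimer_triples_iff)
  have AE: "A \<subseteq> edges \<Gamma>" "A' \<subseteq> edges \<Gamma>" using A A' by (auto simp: dimer_coverings_iff)
  have mid: "((A', S), y) \<in> topspace (triple_space \<Gamma>)" using AE S y by (simp add: triple_in_topspace_iff)
  have "glue \<Gamma> ((A, S), x) ((translate \<Gamma> T A, S), y)"
    using dimer_triples_subset p mid sub unfolding A'_def
    by (intro glue.rebase) (auto simp: y_def T_def)
  moreover have "glue \<Gamma> ((A', S'), restrict y S') ((A', S), y)"
    using dimer_triples_subset q mid sub
    by (intro glue.face) (auto simp: y_def T_def S'_def)
  ultimately have "equivclp (glue \<Gamma>) ((A, S), x) ((A', S'), restrict y S')"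
    unfolding A'_def by (meson equivclp_sym equivclp_trans r_into_equivclp)
  moreover have "0 < restrict y S' s \<and> restrict y S' s < 1" if "s \<in> S'" for s
    using that x01[of s] by (auto simp: y_def S'_def T_def less_le)
  ultimately show ?thesis using that q by blast
qed

text \<open>
  The cycles of an interior point are determined by its labeling, as the decomposition of the
  set of edges with fractional labels. Both base vertices alternate along each of these
  cycles, so on it they are equal or complementary; rebasing at the complementary ones
  identifies the two triples. Alternation, that is the restriction to dimer coverings, enters
  here: for arbitrary vertices the base points need not differ by whole cycles.
\<close>

lemma interior_triples_glued:
  assumes loopless: "loopless_graph \<Gamma>"
    and p: "((A, S), x) \<in> dimer_triples \<Gamma>" "\<And>s. s \<in> S \<Longrightarrow> 0 < x s \<and> x s < 1"
    and q: "((B, R), y) \<in> dimer_triples \<Gamma>" "\<And>s. s \<in> R \<Longrightarrow> 0 < y s \<and> y s < 1"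
    and eq: "eval_triple \<Gamma> ((A, S), x) = eval_triple \<Gamma> ((B, R), y)"
  shows "glue \<Gamma> ((A, S), x) ((B, R), y)"
proof -
  \<comment> \<open>At interior points, fractional labels occur exactly on the cycles of the cube.\<close>
  have union: "\<Union>S = {e \<in> edges \<Gamma>. 0 < eval_triple \<Gamma> ((A, S), x) e \<and> eval_triple \<Gamma> ((A, S), x) e < 1}"
    if "S \<in> cycle_families \<Gamma>" "\<And>s. s \<in> S \<Longrightarrow> 0 < x s \<and> x s < 1" for A S x
  proof (intro equalityI subsetI)
    fix e assume "e \<in> \<Union>S"
    then obtain s where s: "s \<in> S" "e \<in> s" by blast
    then have "e \<in> edges \<Gamma>" using cycle_family_cycle(5)[OF that(1)] by blast
    then show "e \<in> {e \<in> edges \<Gamma>. 0 < eval_triple \<Gamma> ((A, S), x) e \<and> eval_triple \<Gamma> ((A, S), x) e < 1}"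
      using eval_triple_cycle[OF loopless that(1) s] that(2)[OF s(1)] by simp
  next
    fix e assume "e \<in> {e \<in> edges \<Gamma>. 0 < eval_triple \<Gamma> ((A, S), x) e \<and> eval_triple \<Gamma> ((A, S), x) e < 1}"
    then have e: "e \<in> edges \<Gamma>" "0 < eval_triple \<Gamma> ((A, S), x) e" "eval_triple \<Gamma> ((A, S), x) e < 1"
      by simp_all
    show "e \<in> \<Union>S"
    proof (rule ccontr)
      assume "e \<notin> \<Union>S"
      then have "eval_triple \<Gamma> ((A, S), x) e = indicator A e" using e(1) by (rule eval_triple_notin)
      then show False using e(2,3) by (cases "e \<in> A") simp_all
    qed
  qed
  have A: "A \<in> dimer_coverings \<Gamma>" and S: "S \<in> cycle_families \<Gamma>"
    and altA: "alternates \<Gamma> A (\<Union>S)"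
    using p by (auto simp: dimer_triples_iff)
  have B: "B \<in> dimer_coverings \<Gamma>" and R: "R \<in> cycle_families \<Gamma>"
    and altB: "alternates \<Gamma> B (\<Union>R)"
    using q by (auto simp: dimer_triples_iff)
  have "\<Union>S = \<Union>R" using union[where A = A, OF S p(2)] union[where A = B, OF R q(2)] eq by simp
  then have [simp]: "R = S"
    using cyclic_set_decomposition_unique[OF loopless, of R S] cycle_family_cycle(1) S R
      cycle_family_independent by metis
  have SE: "\<Union>S \<subseteq> edges \<Gamma>" using cycle_family_cycle(5)[OF S] by blast
  define T where "T = {s \<in> S. \<exists>e\<in>s. \<not> (e \<in> A \<longleftrightarrow> e \<in> B)}"
  have sub: "T \<subseteq> S" by (auto simp: T_def)
  have opp: "f \<in> A \<longleftrightarrow> f \<notin> B" if t: "t \<in> T" "f \<in> t" for t f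
  proof -
    obtain e where e: "e \<in> t" "e \<in> A \<longleftrightarrow> e \<notin> B" and tS: "t \<in> S" using t by (auto simp: T_def)
    show ?thesis
    proof (rule circle_induct[OF loopless, of t e "\<lambda>f. f \<in> A \<longleftrightarrow> f \<notin> B" f])
      show "t \<subseteq> edges \<Gamma>" "is_circle \<Gamma> t" using cycle_family_cycle[OF S tS] by auto
      fix g h assume "g \<in> t" "h \<in> t" "adjacent_edges \<Gamma> g h" "g \<in> A \<longleftrightarrow> g \<notin> B"
      then show "h \<in> A \<longleftrightarrow> h \<notin> B"
        using alternates_adjacent[OF loopless SE altA, of g h] altB
          alternates_adjacent[OF loopless SE, of B g h] tS by auto
    qed (use e t in auto)
  qed
  have same: "e \<in> A \<longleftrightarrow> e \<in> B" if "e \<notin> \<Union>T" for e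
  proof (cases "e \<in> \<Union>S")
    case True
    then show ?thesis using that unfolding T_def by blast
  next
    case False
    show ?thesis
    proof (cases "e \<in> edges \<Gamma>")
      case True
      have "indicator A e = (indicator B e :: real)"
        using eval_triple_notin[OF False True] eq by (metis \<open>R = S\<close>)
      then show ?thesis by (cases "e \<in> A"; cases "e \<in> B") simp_all
    next
      case False
      then show ?thesis using A B by (auto simp: dimer_coverings_iff)
    qed
  qed
  have tr: "B = translate \<Gamma> T A"
  proof (rule Set.set_eqI)
    fix e
    show "e \<in> B \<longleftrightarrow> e \<in> translate \<Gamma> T A"
      unfolding translate_eq[OF loopless cycle_family_subset[OF S sub]]
      using opp[of _ e] same[of e] by (cases "e \<in> \<Union>T") auto
  qed
  have ex: "\<exists>e. e \<in> s" if "s \<in> S" for s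
    using circle_nonempty[OF cycle_family_cycle(3)[OF S that]] by blast
  have ev: "(if e \<in> A then 1 - x s else x s) = (if e \<in> B then 1 - y s else y s)" if "s \<in> S" "e \<in> s" for s e
    using eval_triple_cycle[OF loopless S that] eq by (metis \<open>R = S\<close>)
  have "y s = x s" if "s \<in> S - T" for s
  proof -
    obtain e where e: "e \<in> s" using ex \<open>s \<in> S - T\<close> by blast
    then have "e \<in> A \<longleftrightarrow> e \<in> B" using that by (auto simp: T_def)
    then show ?thesis using ev[of s e] e that by (auto split: if_splits)
  qed
  moreover have "y s = 1 - x s" if "s \<in> T" for s
  proof -
    obtain e where e: "e \<in> s" using ex \<open>s \<in> T\<close> sub by blast
    then show ?thesis using ev[of s e] opp[OF that e] that sub by (auto split: if_splits)
  qed
  moreover have "((A, S), x) \<in> topspace (triple_space \<Gamma>)" "((B, S), y) \<in> topspace (triple_space \<Gamma>)"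
    using dimer_triples_subset p q by auto
  ultimately show ?thesis
    using sub unfolding \<open>R = S\<close> tr by (intro glue.rebase) simp_all
qed

lemma dimer_triples_glued_if_eval_eq:
  assumes loopless: "loopless_graph \<Gamma>" and "p \<in> dimer_triples \<Gamma>" "q \<in> dimer_triples \<Gamma>"
    and "eval_triple \<Gamma> p = eval_triple \<Gamma> q"
  shows "(p, q) \<in> glue_rel \<Gamma>"
proof -
  have eval: "eval_triple \<Gamma> p = eval_triple \<Gamma> q" if "equivclp (glue \<Gamma>) p q" for p q
    using that by (induction rule: equivclp_induct) (auto dest: eval_triple_glue[OF loopless])
  have rep: "\<exists>A S x. ((A, S), x) \<in> dimer_triples \<Gamma> \<and> (\<forall>s\<in>S. 0 < x s \<and> x s < 1) \<and>
      equivclp (glue \<Gamma>) p ((A, S), x)" if "p \<in> dimer_triples \<Gamma>" for p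
    using that interior_representative[OF loopless] by (metis surj_pair)
  obtain A S x where p': "((A, S), x) \<in> dimer_triples \<Gamma>" "\<forall>s\<in>S. 0 < x s \<and> x s < 1"
      "equivclp (glue \<Gamma>) p ((A, S), x)" using rep assms(2) by blast
  obtain B R y where q': "((B, R), y) \<in> dimer_triples \<Gamma>" "\<forall>s\<in>R. 0 < y s \<and> y s < 1"
      "equivclp (glue \<Gamma>) q ((B, R), y)" using rep assms(3) by blast
  have "glue \<Gamma> ((A, S), x) ((B, R), y)"
    using interior_triples_glued[OF loopless p'(1) _ q'(1)] p' q' eval assms(4) by metis
  then have "equivclp (glue \<Gamma>) p q"
    using p'(3) q'(3) by (meson equivclp_sym equivclp_trans r_into_equivclp)
  then show ?thesis using assms dimer_triples_subset by (auto simp: glue_rel_def)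
qed

section \<open>The evaluation map is an embedding\<close>

lemma quotient_map_equivalence_class:
  assumes r: "equiv (topspace X) r"
  shows "quotient_map X (quotient_topology X r) (\<lambda>p. r `` {p})"
  unfolding quotient_map_def
proof (intro conjI allI impI)
  note top = topspace_quotient_topology[OF r]
  show "(\<lambda>p. r `` {p}) ` topspace X = topspace (quotient_topology X r)"
    unfolding top quotient_def by blast
  fix U assume "U \<subseteq> topspace (quotient_topology X r)"
  then have U: "U \<subseteq> topspace X // r" by (simp add: top)
  have "{p \<in> topspace X. r `` {p} \<in> U} = \<Union>U"
  proof (intro equalityI subsetI)
    fix p assume "p \<in> {p \<in> topspace X. r `` {p} \<in> U}"
    then have "p \<in> r `` {p}" "r `` {p} \<in> U" using equiv_class_self[OF r, of p] by simp_all
    then show "p \<in> \<Union>U" by (rule UnionI[rotated])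
  next
    fix p assume "p \<in> \<Union>U"
    then obtain u where u: "u \<in> U" "p \<in> u" by (rule UnionE)
    then obtain q where q: "u = r `` {q}" using U by (auto elim!: quotientE)
    then have rel: "(q, p) \<in> r" using u by simp
    then have "r `` {p} = u" using equiv_class_eq[OF r rel] q by simp
    moreover have "p \<in> topspace X" using in_quotient_imp_subset[OF r] U u by blast
    ultimately show "p \<in> {p \<in> topspace X. r `` {p} \<in> U}" using u by simp
  qed
  then show "openin X {p \<in> topspace X. r `` {p} \<in> U} \<longleftrightarrow> openin (quotient_topology X r) U"
    using U by (simp add: openin_quotient_topology[OF r])
qed

lemma quotient_map_glue:
  "quotient_map (triple_space \<Gamma>) (cubed_complex \<Gamma>) (\<lambda>p. glue_rel \<Gamma> `` {p})"
  unfolding cubed_complex_def by (rule quotient_map_equivalence_class[OF equiv_glue_rel])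

lemma continuous_map_from_sum_topology:
  assumes "\<And>i. i \<in> I \<Longrightarrow> continuous_map (X i) Y (\<lambda>x. f (i, x))"
  shows "continuous_map (sum_topology X I) Y f"
  unfolding continuous_map_def
proof (intro conjI allI impI)
  show "f \<in> topspace (sum_topology X I) \<rightarrow> topspace Y"
    using assms by (auto simp: continuous_map_def Pi_iff)
  fix U assume U: "openin Y U"
  have "openin (X i) {x. (i, x) \<in> {p \<in> topspace (sum_topology X I). f p \<in> U}}" if "i \<in> I" for i
    using openin_continuous_map_preimage[OF assms[OF that] U] that by simp
  then show "openin (sum_topology X I) {p \<in> topspace (sum_topology X I). f p \<in> U}"
    by (auto simp: openin_sum_topology)
qed

lemma continuous_map_eval_triple:
  assumes loopless: "loopless_graph \<Gamma>"
  shows "continuous_map (triple_space \<Gamma>) (cube_space (edges \<Gamma>)) (eval_triple \<Gamma>)"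
  unfolding triple_space_def
proof (rule continuous_map_from_sum_topology)
  fix i assume i: "i \<in> based_cubes \<Gamma>"
  obtain A S where AS: "i = (A, S)" by (cases i)
  have A: "A \<subseteq> edges \<Gamma>" and S: "S \<in> cycle_families \<Gamma>" using i AS by (auto simp: based_cubes_def)
  have unit: "eval_triple \<Gamma> ((A, S), x) \<in> edges \<Gamma> \<rightarrow>\<^sub>E {0..1}" if "x \<in> S \<rightarrow>\<^sub>E {0..1}" for x
    using eval_triple_unit_interval[OF loopless] A S that by (simp add: triple_in_topspace_iff)
  have "continuous_map (cube_space S) unit_interval (\<lambda>x. eval_triple \<Gamma> ((A, S), x) e)"
    if e: "e \<in> edges \<Gamma>" for e
    unfolding continuous_map_in_subtopology
  proof
    show "(\<lambda>x. eval_triple \<Gamma> ((A, S), x) e) \<in> topspace (cube_space S) \<rightarrow> {0..1}"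
      using unit e by (auto simp: PiE_iff)
    show "continuous_map (cube_space S) euclideanreal (\<lambda>x. eval_triple \<Gamma> ((A, S), x) e)"
    proof (cases "e \<in> \<Union>S")
      case True
      then obtain s where s: "s \<in> S" "e \<in> s" by (rule UnionE)
      have "continuous_map (cube_space S) unit_interval (\<lambda>x. x s)"
        unfolding cube_space_def using s(1) by (rule continuous_map_product_projection)
      then have "continuous_map (cube_space S) euclideanreal (\<lambda>x. x s)"
        by (rule continuous_map_into_fulltopology)
      then have "continuous_map (cube_space S) euclideanreal (\<lambda>x. if e \<in> A then 1 - x s else x s)"
        by (cases "e \<in> A") (simp_all add: continuous_map_diff)
      then show ?thesis unfolding eval_triple_cycle[OF loopless S s] .
    next
      case False
      then show ?thesis unfolding eval_triple_notin[OF False e] by simp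
    qed
  qed
  then have "continuous_map (cube_space S) (cube_space (edges \<Gamma>)) (\<lambda>x. eval_triple \<Gamma> ((A, S), x))"
    using unit unfolding cube_space_def[of "edges \<Gamma>"] continuous_map_componentwise
    by (auto simp: PiE_iff)
  then show "continuous_map (case i of (A, S) \<Rightarrow> cube_space S) (cube_space (edges \<Gamma>))
      (\<lambda>x. eval_triple \<Gamma> (i, x))" by (simp add: AS)
qed

lemma eval_map_glue_class:
  assumes "loopless_graph \<Gamma>" "p \<in> topspace (triple_space \<Gamma>)"
  shows "eval_map \<Gamma> (glue_rel \<Gamma> `` {p}) = eval_triple \<Gamma> p"
proof (rule eval_map_class[OF assms(1)])
  show "glue_rel \<Gamma> `` {p} \<in> topspace (cubed_complex \<Gamma>)"
    using quotient_imp_surjective_map[OF quotient_map_glue] assms(2) by blast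
  show "p \<in> glue_rel \<Gamma> `` {p}" by (rule equiv_class_self[OF equiv_glue_rel assms(2)])
qed

lemma continuous_map_eval_map:
  assumes "loopless_graph \<Gamma>"
  shows "continuous_map (cubed_complex \<Gamma>) (cube_space (edges \<Gamma>)) (eval_map \<Gamma>)"
proof (rule continuous_compose_quotient_map[OF quotient_map_glue])
  show "continuous_map (triple_space \<Gamma>) (cube_space (edges \<Gamma>)) (eval_map \<Gamma> \<circ> (\<lambda>p. glue_rel \<Gamma> `` {p}))"
    by (rule continuous_map_eq[OF continuous_map_eval_triple[OF assms]])
      (simp add: eval_map_glue_class[OF assms])
qed

lemma topspace_dimer_complex:
  assumes loopless: "loopless_graph \<Gamma>"
  shows "topspace (dimer_complex \<Gamma>) = (\<lambda>p. glue_rel \<Gamma> `` {p}) ` dimer_triples \<Gamma>"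
proof (intro equalityI subsetI)
  fix a assume a: "a \<in> topspace (dimer_complex \<Gamma>)"
  then obtain A S x where p: "((A, S), x) \<in> a" and cube: "cube_vertices \<Gamma> (A, S) \<subseteq> dimer_coverings \<Gamma>"
    and "a \<in> topspace (cubed_complex \<Gamma>)"
    by (auto simp: dimer_complex_def)
  then obtain q where q: "q \<in> topspace (triple_space \<Gamma>)" "a = glue_rel \<Gamma> `` {q}"
    using quotient_imp_surjective_map[OF quotient_map_glue] by blast
  then have rel: "(q, ((A, S), x)) \<in> glue_rel \<Gamma>" using p by simp
  then have "((A, S), x) \<in> topspace (triple_space \<Gamma>)" by (simp add: glue_rel_def)
  then have "((A, S), x) \<in> dimer_triples \<Gamma>"
    using cube cube_of_dimer_coverings_iff[OF loopless]
    by (simp add: dimer_triples_iff triple_in_topspace_iff)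
  moreover have "a = glue_rel \<Gamma> `` {((A, S), x)}"
    unfolding q(2) by (rule equiv_class_eq[OF equiv_glue_rel rel])
  ultimately show "a \<in> (\<lambda>p. glue_rel \<Gamma> `` {p}) ` dimer_triples \<Gamma>" by (rule rev_image_eqI)
next
  fix a assume "a \<in> (\<lambda>p. glue_rel \<Gamma> `` {p}) ` dimer_triples \<Gamma>"
  then obtain p where p: "p \<in> dimer_triples \<Gamma>" "a = glue_rel \<Gamma> `` {p}" by blast
  obtain A S x where ASx: "p = ((A, S), x)" by (metis surj_pair)
  have top: "p \<in> topspace (triple_space \<Gamma>)" using p(1) dimer_triples_subset by blast
  then have "a \<in> topspace (cubed_complex \<Gamma>)"
    using quotient_imp_surjective_map[OF quotient_map_glue] p(2) by blast
  moreover have "((A, S), x) \<in> a"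
    using equiv_class_self[OF equiv_glue_rel top] p(2) ASx by simp
  moreover have "cube_vertices \<Gamma> (A, S) \<subseteq> dimer_coverings \<Gamma>"
    using p(1) cube_of_dimer_coverings_iff[OF loopless] by (simp add: ASx dimer_triples_iff)
  ultimately show "a \<in> topspace (dimer_complex \<Gamma>)" unfolding dimer_complex_def by auto
qed

lemma compact_space_cube_space: "compact_space (cube_space J)"
  unfolding cube_space_def compact_space_product_topology by (simp add: compact_space_subtopology)

lemma Hausdorff_space_cube_space: "Hausdorff_space (cube_space J)"
  unfolding cube_space_def Hausdorff_space_product_topology by (simp add: Hausdorff_space_subtopology)

text \<open>
  The cubes in question are finitely many and each is compact.
\<close>

lemma compactin_dimer_triples:
  assumes "finite_loopless_graph \<Gamma>"
  shows "compactin (triple_space \<Gamma>) (dimer_triples \<Gamma>)"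
proof -
  define J where "J = {(A, S). A \<in> dimer_coverings \<Gamma> \<and> S \<in> cycle_families \<Gamma> \<and> alternates \<Gamma> A (\<Union>S)}"
  define P where "P i = Pair i ` topspace (cube_space (snd i))" for i :: "'b set \<times> 'b set set"
  have "J \<subseteq> Pow (edges \<Gamma>) \<times> Pow (Pow (edges \<Gamma>))"
  proof
    fix i assume "i \<in> J"
    then obtain A S where i: "i = (A, S)" "A \<in> dimer_coverings \<Gamma>" "S \<in> cycle_families \<Gamma>"
      by (auto simp: J_def)
    then show "i \<in> Pow (edges \<Gamma>) \<times> Pow (Pow (edges \<Gamma>))"
      using cycle_family_cycle(5)[OF i(3)] by (auto simp: dimer_coverings_iff)
  qed
  then have fin: "finite J"
    by (rule finite_subset) (use assms in \<open>simp add: finite_loopless_graph_def\<close>)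
  have based: "J \<subseteq> based_cubes \<Gamma>" by (auto simp: J_def based_cubes_def dimer_coverings_iff)
  have "compactin (triple_space \<Gamma>) (P i)" if "i \<in> J" for i
  proof -
    have "continuous_map (case i of (A, S) \<Rightarrow> cube_space S) (triple_space \<Gamma>) (Pair i)"
      unfolding triple_space_def using based that
      by (intro continuous_map_component_injection) blast
    then have "continuous_map (cube_space (snd i)) (triple_space \<Gamma>) (Pair i)"
      by (simp add: case_prod_beta)
    then show ?thesis
      unfolding P_def using compact_space_cube_space unfolding compact_space_def
      by (intro image_compactin)
  qed
  then have "compactin (triple_space \<Gamma>) (\<Union>(P ` J))" using fin by (intro compactin_Union) auto
  moreover have "\<Union>(P ` J) = dimer_triples \<Gamma>" unfolding J_def P_def dimer_triples_def by auto
  ultimately show ?thesis by simp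
qed

lemma compact_space_dimer_complex:
  assumes "finite_loopless_graph \<Gamma>"
  shows "compact_space (dimer_complex \<Gamma>)"
proof -
  have loopless: "loopless_graph \<Gamma>" using assms by (simp add: finite_loopless_graph_def)
  have "compactin (cubed_complex \<Gamma>) ((\<lambda>p. glue_rel \<Gamma> `` {p}) ` dimer_triples \<Gamma>)"
    by (rule image_compactin[OF compactin_dimer_triples[OF assms]
        quotient_imp_continuous_map[OF quotient_map_glue]])
  moreover have "dimer_complex \<Gamma> = subtopology (cubed_complex \<Gamma>) (topspace (dimer_complex \<Gamma>))"
    unfolding dimer_complex_def by (metis subtopology_restrict topspace_subtopology)
  ultimately show ?thesis
    unfolding topspace_dimer_complex[OF loopless] by (metis compact_space_subtopology)
qed

text \<open>
  A continuous injection from a compact space into a Hausdorff space is an embedding.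
\<close>

lemma embedding_map_eval_map:
  assumes "finite_loopless_graph \<Gamma>"
  shows "embedding_map (dimer_complex \<Gamma>) (cube_space (edges \<Gamma>)) (eval_map \<Gamma>)"
proof (rule continuous_imp_embedding_map)
  have loopless: "loopless_graph \<Gamma>" using assms by (simp add: finite_loopless_graph_def)
  show "compact_space (dimer_complex \<Gamma>)" by (rule compact_space_dimer_complex[OF assms])
  show "Hausdorff_space (cube_space (edges \<Gamma>))" by (rule Hausdorff_space_cube_space)
  show "continuous_map (dimer_complex \<Gamma>) (cube_space (edges \<Gamma>)) (eval_map \<Gamma>)"
    unfolding dimer_complex_def
    by (rule continuous_map_from_subtopology[OF continuous_map_eval_map[OF loopless]])
  show "inj_on (eval_map \<Gamma>) (topspace (dimer_complex \<Gamma>))"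
    unfolding topspace_dimer_complex[OF loopless]
  proof (rule inj_onI, elim imageE)
    fix a b p q
    assume p: "a = glue_rel \<Gamma> `` {p}" "p \<in> dimer_triples \<Gamma>"
      and q: "b = glue_rel \<Gamma> `` {q}" "q \<in> dimer_triples \<Gamma>"
      and "eval_map \<Gamma> a = eval_map \<Gamma> b"
    then have "eval_triple \<Gamma> p = eval_triple \<Gamma> q"
      using eval_map_glue_class[OF loopless subsetD[OF dimer_triples_subset p(2)]]
        eval_map_glue_class[OF loopless subsetD[OF dimer_triples_subset q(2)]] by simp
    then have "(p, q) \<in> glue_rel \<Gamma>"
      using dimer_triples_glued_if_eval_eq[OF loopless] p q by simp
    then show "a = b" unfolding p(1) q(1) by (rule equiv_class_eq[OF equiv_glue_rel])
  qed
qed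

lemma eval_map_image:
  assumes "finite_loopless_graph \<Gamma>"
  shows "eval_map \<Gamma> ` topspace (dimer_complex \<Gamma>) = odd_cycle_free_labelings \<Gamma>"
proof -
  have loopless: "loopless_graph \<Gamma>" using assms by (simp add: finite_loopless_graph_def)
  have "eval_map \<Gamma> ` topspace (dimer_complex \<Gamma>) = eval_triple \<Gamma> ` dimer_triples \<Gamma>"
    unfolding topspace_dimer_complex[OF loopless] image_image
    by (rule image_cong[OF refl]) (use eval_map_glue_class[OF loopless] dimer_triples_subset in blast)
  then show ?thesis by (simp add: eval_image_dimer_triples[OF assms])
qed

section \<open>The image is a path component\<close>

lemma topspace_labeling_space:
  assumes "finite_loopless_graph \<Gamma>"
  shows "topspace (labeling_space \<Gamma>) = dimer_labelings \<Gamma>"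
  using dimer_labelings_subset_cube[OF assms] by (auto simp: labeling_space_def)

lemma continuous_map_label:
  assumes "e \<in> edges \<Gamma>"
  shows "continuous_map (labeling_space \<Gamma>) euclideanreal (\<lambda>l. l e)"
proof -
  have "continuous_map (cube_space (edges \<Gamma>)) unit_interval (\<lambda>l. l e)"
    unfolding cube_space_def using assms by (rule continuous_map_product_projection)
  then show ?thesis
    unfolding labeling_space_def
    by (intro continuous_map_from_subtopology) (rule continuous_map_into_fulltopology)
qed

text \<open>
  The complement is the union over the odd cycles \<open>c\<close> of the sets of labelings
  that are positive on \<open>c\<close>. These sets are open, and by
  \<open>odd_cycle_labels\<close> they are also given by the closed condition that the labels
  on \<open>c\<close> are \<open>1/2\<close>. As there are finitely many cycles, the union is
  clopen.
\<close>

lemma odd_cycle_free_labelings_clopen: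
  assumes G: "finite_loopless_graph \<Gamma>"
  shows "openin (labeling_space \<Gamma>) (odd_cycle_free_labelings \<Gamma>)"
    and "closedin (labeling_space \<Gamma>) (odd_cycle_free_labelings \<Gamma>)"
proof -
  let ?L = "labeling_space \<Gamma>"
  have loopless: "loopless_graph \<Gamma>" and fin: "finite (edges \<Gamma>)"
    using G by (auto simp: finite_loopless_graph_def)
  note top = topspace_labeling_space[OF G]
  define C where "C = {c. is_cycle \<Gamma> c \<and> odd (card c)}"
  define pos_odd where "pos_odd = (\<Union>c\<in>C. \<Inter>e\<in>c. {l \<in> topspace ?L. l e \<in> {0<..}})"
  have C: "c \<subseteq> edges \<Gamma>" "finite c" "c \<noteq> {}" if "c \<in> C" for c
    using that circle_nonempty by (auto simp: C_def is_cycle_def cyclic_set_iff)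
  have "C \<subseteq> Pow (edges \<Gamma>)" using C by blast
  then have finC: "finite C" using fin by (simp add: finite_subset)
  have "openin ?L pos_odd"
    unfolding pos_odd_def
  proof (intro openin_Union)
    fix U assume "U \<in> (\<lambda>c. \<Inter>e\<in>c. {l \<in> topspace ?L. l e \<in> {0<..}}) ` C"
    then obtain c where c: "c \<in> C" "U = (\<Inter>e\<in>c. {l \<in> topspace ?L. l e \<in> {0<..}})" by blast
    have "openin ?L {l \<in> topspace ?L. l e \<in> {0<..}}" if "e \<in> c" for e
      using continuous_map_label[of e \<Gamma>] C[OF c(1)] that
      by (intro openin_continuous_map_preimage) auto
    then show "openin ?L U" unfolding c(2) using C[OF c(1)] by (intro openin_Inter) auto
  qed
  have half: "(\<Inter>e\<in>c. {l \<in> topspace ?L. l e \<in> {0<..}}) = (\<Inter>e\<in>c. {l \<in> topspace ?L. l e \<in> {1/2}})"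
    if c: "c \<in> C" for c
  proof (intro equalityI subsetI)
    fix l assume l: "l \<in> (\<Inter>e\<in>c. {l \<in> topspace ?L. l e \<in> {0<..}})"
    then have pos: "0 < l e" if "e \<in> c" for e using that by auto
    have lL: "l \<in> dimer_labelings \<Gamma>" using l C(3)[OF c] top by auto
    have "l e = 1 / 2" if "e \<in> c" for e
      using odd_cycle_labels[OF loopless fin lL _ _ pos that] c by (simp add: C_def)
    then show "l \<in> (\<Inter>e\<in>c. {l \<in> topspace ?L. l e \<in> {1/2}})" using lL top by simp
  next
    fix l assume "l \<in> (\<Inter>e\<in>c. {l \<in> topspace ?L. l e \<in> {1/2}})"
    then show "l \<in> (\<Inter>e\<in>c. {l \<in> topspace ?L. l e \<in> {0<..}})" by auto
  qed
  have "closedin ?L pos_odd"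
    unfolding pos_odd_def
  proof (intro closedin_Union finite_imageI finC)
    fix U assume "U \<in> (\<lambda>c. \<Inter>e\<in>c. {l \<in> topspace ?L. l e \<in> {0<..}}) ` C"
    then obtain c where c: "c \<in> C" "U = (\<Inter>e\<in>c. {l \<in> topspace ?L. l e \<in> {1/2}})" using half by blast
    have "closedin ?L {l \<in> topspace ?L. l e \<in> {1/2}}" if "e \<in> c" for e
      using continuous_map_label[of e \<Gamma>] C[OF c(1)] that
      by (intro closedin_continuous_map_preimage) auto
    then show "closedin ?L U" unfolding c(2) using C[OF c(1)] by (intro closedin_Inter) auto
  qed
  have pos_odd_iff: "l \<in> pos_odd \<longleftrightarrow> l \<in> dimer_labelings \<Gamma> \<and> (\<exists>c. is_cycle \<Gamma> c \<and> odd (card c) \<and> (\<forall>e\<in>c. 0 < l e))" for l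
  proof
    assume "l \<in> pos_odd"
    then obtain c where "c \<in> C" "\<forall>e\<in>c. l \<in> topspace ?L \<and> 0 < l e" by (auto simp: pos_odd_def)
    then show "l \<in> dimer_labelings \<Gamma> \<and> (\<exists>c. is_cycle \<Gamma> c \<and> odd (card c) \<and> (\<forall>e\<in>c. 0 < l e))"
      using C(3) top by (auto simp: C_def)
  next
    assume "l \<in> dimer_labelings \<Gamma> \<and> (\<exists>c. is_cycle \<Gamma> c \<and> odd (card c) \<and> (\<forall>e\<in>c. 0 < l e))"
    then show "l \<in> pos_odd" using top by (auto simp: pos_odd_def C_def)
  qed
  have eq: "odd_cycle_free_labelings \<Gamma> = topspace ?L - pos_odd"
    unfolding odd_cycle_free_labelings_def top
    by (rule Set.set_eqI) (simp add: pos_odd_iff not_less[symmetric], blast)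
  show "openin ?L (odd_cycle_free_labelings \<Gamma>)" "closedin ?L (odd_cycle_free_labelings \<Gamma>)"
    unfolding eq using \<open>openin ?L pos_odd\<close> \<open>closedin ?L pos_odd\<close> by (auto intro: openin_diff closedin_diff)
qed

lemma path_component_of_segment:
  assumes lm: "l \<in> dimer_labelings \<Gamma>" "m \<in> dimer_labelings \<Gamma>" and G: "finite_loopless_graph \<Gamma>"
    and seg: "\<And>t. t \<in> {0..1} \<Longrightarrow> (\<lambda>e\<in>edges \<Gamma>. (1 - t) * l e + t * m e) \<in> dimer_labelings \<Gamma>"
  shows "path_component_of (labeling_space \<Gamma>) l m"
proof -
  define g where "g t = (\<lambda>e\<in>edges \<Gamma>. (1 - t) * l e + t * m e)" for t :: real
  have unit: "g t \<in> edges \<Gamma> \<rightarrow>\<^sub>E {0..1}" if "t \<in> {0..1}" for t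
    using subsetD[OF dimer_labelings_subset_cube[OF G] seg[OF that]] by (simp only: g_def topspace_cube_space)
  have "continuous_map unit_interval unit_interval (\<lambda>t. g t e)" if "e \<in> edges \<Gamma>" for e
    unfolding continuous_map_in_subtopology
  proof
    have "continuous_on {0..1} (\<lambda>t. (1 - t) * l e + t * m e)" by (intro continuous_intros)
    then show "continuous_map unit_interval euclideanreal (\<lambda>t. g t e)"
      using that by (simp add: g_def)
    show "(\<lambda>t. g t e) \<in> topspace unit_interval \<rightarrow> {0..1}"
      using PiE_mem[OF unit that] by simp
  qed
  then have "continuous_map unit_interval (cube_space (edges \<Gamma>)) g"
    unfolding cube_space_def continuous_map_componentwise by (auto simp: g_def)
  then have "pathin (labeling_space \<Gamma>) g"
    unfolding labeling_space_def pathin_subtopology unfolding pathin_def using seg by (simp add: g_def)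
  moreover have "g 0 = l" "g 1 = m"
    using lm by (auto simp: g_def dimer_labelings_iff PiE_restrict)
  ultimately show ?thesis unfolding path_component_of_def by blast
qed

lemma eval_triple_zero:
  assumes "loopless_graph \<Gamma>" "S \<in> cycle_families \<Gamma>" "\<And>s. s \<in> S \<Longrightarrow> x s = 0"
  shows "eval_triple \<Gamma> ((A, S), x) = char_labeling \<Gamma> A"
proof
  fix e
  consider s where "s \<in> S" "e \<in> s" | "e \<notin> \<Union>S" "e \<in> edges \<Gamma>" | "e \<notin> edges \<Gamma>" by blast
  then show "eval_triple \<Gamma> ((A, S), x) e = char_labeling \<Gamma> A e"
  proof cases
    case (1 s)
    then have "e \<in> edges \<Gamma>" using cycle_family_cycle(5)[OF assms(2)] by blast
    then show ?thesis
      using eval_triple_cycle[OF assms(1,2) 1] assms(3)[OF 1(1)] by (simp add: char_labeling_def)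
  next
    case 2
    then show ?thesis using eval_triple_notin[OF 2] by (simp add: char_labeling_def)
  next
    case 3
    then show ?thesis by (simp add: eval_triple_def char_labeling_def)
  qed
qed

lemma char_labeling_odd_cycle_free:
  assumes G: "finite_loopless_graph \<Gamma>" and A: "A \<in> dimer_coverings \<Gamma>"
  shows "char_labeling \<Gamma> A \<in> odd_cycle_free_labelings \<Gamma>"
proof -
  have loopless: "loopless_graph \<Gamma>" using G by (simp add: finite_loopless_graph_def)
  have S: "{} \<in> cycle_families \<Gamma>" by (simp add: cycle_families_def)
  have "alternates \<Gamma> A (\<Union>{})" by (simp add: alternates_def edges_at_def)
  then have "((A, {}), \<lambda>_. undefined) \<in> dimer_triples \<Gamma>"
    using A S by (simp add: dimer_triples_iff)
  from eval_dimer_triple_odd_cycle_free[OF G this]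
  have "eval_triple \<Gamma> ((A, {}), \<lambda>_. undefined) \<in> odd_cycle_free_labelings \<Gamma>" .
  moreover have "eval_triple \<Gamma> ((A, {}), \<lambda>_. undefined) = char_labeling \<Gamma> A"
    by (rule eval_triple_zero[OF loopless S]) simp
  ultimately show ?thesis by simp
qed

text \<open>
  In the coordinates of the cube this is the segment from the base vertex to
  \<open>x\<close>. The evaluation map is affine on each cube, so the segment stays in the
  image of the cube.
\<close>

lemma path_component_of_cube_base:
  assumes G: "finite_loopless_graph \<Gamma>" and p: "((A, S), x) \<in> dimer_triples \<Gamma>"
  shows "path_component_of (labeling_space \<Gamma>) (char_labeling \<Gamma> A) (eval_triple \<Gamma> ((A, S), x))"
proof (rule path_component_of_segment[OF _ _ G])
  have loopless: "loopless_graph \<Gamma>" using G by (simp add: finite_loopless_graph_def)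
  have A: "A \<in> dimer_coverings \<Gamma>" and S: "S \<in> cycle_families \<Gamma>"
    and alt: "alternates \<Gamma> A (\<Union>S)" and x: "x \<in> S \<rightarrow>\<^sub>E {0..1}"
    using p by (auto simp: dimer_triples_iff)
  show "char_labeling \<Gamma> A \<in> dimer_labelings \<Gamma>"
    using char_labeling_odd_cycle_free[OF G A] by (simp add: odd_cycle_free_labelings_def)
  show "eval_triple \<Gamma> ((A, S), x) \<in> dimer_labelings \<Gamma>" by (rule eval_dimer_triple_labeling[OF G p])
  fix t :: real assume t: "t \<in> {0..1}"
  define y where "y = (\<lambda>s\<in>S. t * x s)"
  have "y \<in> S \<rightarrow>\<^sub>E {0..1}" using x t by (auto simp: y_def PiE_iff intro: mult_le_one)
  then have "((A, S), y) \<in> dimer_triples \<Gamma>" using A S alt by (simp add: dimer_triples_iff)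
  then have "eval_triple \<Gamma> ((A, S), y) \<in> dimer_labelings \<Gamma>" by (rule eval_dimer_triple_labeling[OF G])
  moreover have "eval_triple \<Gamma> ((A, S), y) =
      (\<lambda>e\<in>edges \<Gamma>. (1 - t) * char_labeling \<Gamma> A e + t * eval_triple \<Gamma> ((A, S), x) e)"
  proof
    fix e
    consider s where "s \<in> S" "e \<in> s" | "e \<notin> \<Union>S" "e \<in> edges \<Gamma>" | "e \<notin> edges \<Gamma>" by blast
    then show "eval_triple \<Gamma> ((A, S), y) e =
        (\<lambda>e\<in>edges \<Gamma>. (1 - t) * char_labeling \<Gamma> A e + t * eval_triple \<Gamma> ((A, S), x) e) e"
    proof cases
      case (1 s)
      then have "e \<in> edges \<Gamma>" using cycle_family_cycle(5)[OF S] by blast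
      then show ?thesis
        using eval_triple_cycle[OF loopless S 1] 1(1) by (simp add: char_labeling_def y_def algebra_simps)
    next
      case 2
      then show ?thesis using eval_triple_notin[OF 2] by (simp add: char_labeling_def algebra_simps)
    next
      case 3
      then show ?thesis by (simp add: eval_triple_def)
    qed
  qed
  ultimately show "(\<lambda>e\<in>edges \<Gamma>. (1 - t) * char_labeling \<Gamma> A e + t * eval_triple \<Gamma> ((A, S), x) e)
      \<in> dimer_labelings \<Gamma>" by simp
qed

text \<open>
  Two dimer coverings have one edge each at a vertex, so on the segment between them the
  labels there are \<open>1 - t\<close> and \<open>t\<close>, or a single \<open>1\<close> if
  the two edges coincide.
\<close>

lemma path_component_of_dimer_coverings:
  assumes G: "finite_loopless_graph \<Gamma>" and A: "A \<in> dimer_coverings \<Gamma>" and B: "B \<in> dimer_coverings \<Gamma>"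
  shows "path_component_of (labeling_space \<Gamma>) (char_labeling \<Gamma> A) (char_labeling \<Gamma> B)"
proof (rule path_component_of_segment[OF _ _ G])
  have fin: "finite (edges \<Gamma>)" using G by (simp add: finite_loopless_graph_def)
  show "char_labeling \<Gamma> A \<in> dimer_labelings \<Gamma>" "char_labeling \<Gamma> B \<in> dimer_labelings \<Gamma>"
    using char_labeling_odd_cycle_free[OF G] A B by (simp_all add: odd_cycle_free_labelings_def)
  fix t :: real assume t: "t \<in> {0..1}"
  define l where "l = (\<lambda>e\<in>edges \<Gamma>. (1 - t) * char_labeling \<Gamma> A e + t * char_labeling \<Gamma> B e)"
  have le: "l e = (1 - t) * indicator A e + t * indicator B e" if "e \<in> edges \<Gamma>" for e
    using that by (simp add: l_def char_labeling_def)
  have "l \<in> dimer_labelings \<Gamma>"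
    unfolding dimer_labelings_iff
  proof (intro conjI[of "_ \<in> _"] ballI)
    show "l \<in> edges \<Gamma> \<rightarrow>\<^sub>E {0..}" using t le by (auto simp: l_def char_labeling_def)
    fix v assume v: "v \<in> verts \<Gamma>"
    let ?N = "edges_at \<Gamma> (edges \<Gamma>) v"
    have N: "finite ?N" using fin by (simp add: edges_at_def)
    obtain a where a: "edges_at \<Gamma> A v = {a}" using A v by (auto simp: dimer_coverings_iff)
    obtain b where b: "edges_at \<Gamma> B v = {b}" using B v by (auto simp: dimer_coverings_iff)
    have inA: "e \<in> A \<longleftrightarrow> e = a" and inB: "e \<in> B \<longleftrightarrow> e = b" if "e \<in> ?N" for e
      using a b that unfolding edges_at_def by blast+
    have "a \<in> edges_at \<Gamma> A v" "b \<in> edges_at \<Gamma> B v" using a b by simp_all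
    then have ab: "a \<in> ?N" "b \<in> ?N"
      using A B by (auto simp: edges_at_def dimer_coverings_iff)
    have lN: "l e = (1 - t) * (if e = a then 1 else 0) + t * (if e = b then 1 else 0)" if "e \<in> ?N" for e
      using le[of e] inA[OF that] inB[OF that] that by (simp add: edges_at_def indicator_def)
    show "sum l ?N = 1 \<and> card {e \<in> ?N. l e \<noteq> 0} \<in> {1, 2}"
    proof (cases "a = b")
      case True
      show ?thesis by (rule sum_label_single[OF N ab(1)]) (use lN ab True in auto)
    next
      case False
      show ?thesis by (rule sum_label_pair[OF N ab False]) (use lN ab False in auto)
    qed
  qed
  then show "(\<lambda>e\<in>edges \<Gamma>. (1 - t) * char_labeling \<Gamma> A e + t * char_labeling \<Gamma> B e) \<in> dimer_labelings \<Gamma>"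
    by (simp add: l_def)
qed

text \<open>
  Each labeling in the set is joined to the base vertex of its cube and from there to
  \<open>A\<close>. No path leaves the set, because it is clopen.
\<close>

lemma odd_cycle_free_labelings_path_component:
  assumes G: "finite_loopless_graph \<Gamma>" and A: "A \<in> dimer_coverings \<Gamma>"
  shows "odd_cycle_free_labelings \<Gamma> = path_component_of_set (labeling_space \<Gamma>) (char_labeling \<Gamma> A)"
proof
  let ?L = "labeling_space \<Gamma>" and ?a = "char_labeling \<Gamma> A"
  have a: "?a \<in> odd_cycle_free_labelings \<Gamma>" by (rule char_labeling_odd_cycle_free[OF G A])
  show "odd_cycle_free_labelings \<Gamma> \<subseteq> path_component_of_set ?L ?a"
  proof
    fix l assume "l \<in> odd_cycle_free_labelings \<Gamma>"
    then obtain p where "p \<in> dimer_triples \<Gamma>" "l = eval_triple \<Gamma> p"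
      using odd_cycle_free_labeling_in_image[OF G] by blast
    then obtain B S x where p: "((B, S), x) \<in> dimer_triples \<Gamma>" "l = eval_triple \<Gamma> ((B, S), x)"
      by (metis surj_pair)
    then have "B \<in> dimer_coverings \<Gamma>" by (simp add: dimer_triples_iff)
    then have "path_component_of ?L ?a (char_labeling \<Gamma> B)"
      by (rule path_component_of_dimer_coverings[OF G A])
    also have "path_component_of ?L (char_labeling \<Gamma> B) l"
      unfolding p(2) by (rule path_component_of_cube_base[OF G p(1)])
    finally (path_component_of_trans) show "l \<in> path_component_of_set ?L ?a" by simp
  qed
  have "connectedin ?L (path_component_of_set ?L ?a)"
    by (rule path_connectedin_imp_connectedin[OF path_connectedin_path_component_of])
  then have "path_component_of_set ?L ?a \<subseteq> odd_cycle_free_labelings \<Gamma> \<or>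
      disjnt (path_component_of_set ?L ?a) (odd_cycle_free_labelings \<Gamma>)"
    by (rule connectedin_clopen_cases) (rule odd_cycle_free_labelings_clopen[OF G])+
  moreover have "path_component_of ?L ?a ?a"
    using a topspace_labeling_space[OF G]
    by (simp add: path_component_of_refl odd_cycle_free_labelings_def)
  ultimately show "path_component_of_set ?L ?a \<subseteq> odd_cycle_free_labelings \<Gamma>"
    using a by (auto simp: disjnt_iff)
qed

theorem theorem9p5:
  fixes \<Gamma> :: "('v, 'e) multigraph"
  assumes "finite_loopless_graph \<Gamma>"
  shows "embedding_map (dimer_complex \<Gamma>) (cube_space (edges \<Gamma>)) (eval_map \<Gamma>) \<and>
    (dimer_coverings \<Gamma> = {} \<longrightarrow> eval_map \<Gamma> ` topspace (dimer_complex \<Gamma>) = {}) \<and>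
    (dimer_coverings \<Gamma> \<noteq> {} \<longrightarrow>
       eval_map \<Gamma> ` topspace (dimer_complex \<Gamma>) \<in> path_components_of (labeling_space \<Gamma>)) \<and>
    (\<forall>A \<in> dimer_coverings \<Gamma>.
       char_labeling \<Gamma> A \<in> dimer_labelings \<Gamma> \<and>
       char_labeling \<Gamma> A \<in> eval_map \<Gamma> ` topspace (dimer_complex \<Gamma>))"
proof (intro conjI impI ballI)
  have loopless: "loopless_graph \<Gamma>" using assms by (simp add: finite_loopless_graph_def)
  note image = eval_map_image[OF assms]
  show "embedding_map (dimer_complex \<Gamma>) (cube_space (edges \<Gamma>)) (eval_map \<Gamma>)"
    by (rule embedding_map_eval_map[OF assms])
  show "eval_map \<Gamma> ` topspace (dimer_complex \<Gamma>) = {}" if "dimer_coverings \<Gamma> = {}"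
    using that by (simp add: topspace_dimer_complex[OF loopless] dimer_triples_def)
  show "eval_map \<Gamma> ` topspace (dimer_complex \<Gamma>) \<in> path_components_of (labeling_space \<Gamma>)"
    if "dimer_coverings \<Gamma> \<noteq> {}"
  proof -
    obtain A where A: "A \<in> dimer_coverings \<Gamma>" using \<open>dimer_coverings \<Gamma> \<noteq> {}\<close> by blast
    have "char_labeling \<Gamma> A \<in> topspace (labeling_space \<Gamma>)"
      using char_labeling_odd_cycle_free[OF assms A] topspace_labeling_space[OF assms]
      by (simp add: odd_cycle_free_labelings_def)
    then show ?thesis
      unfolding image odd_cycle_free_labelings_path_component[OF assms A]
      by (simp add: path_component_in_path_components_of)
  qed
  fix A assume "A \<in> dimer_coverings \<Gamma>"
  then have "char_labeling \<Gamma> A \<in> odd_cycle_free_labelings \<Gamma>"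
    by (rule char_labeling_odd_cycle_free[OF assms])
  then show "char_labeling \<Gamma> A \<in> dimer_labelings \<Gamma>"
    "char_labeling \<Gamma> A \<in> eval_map \<Gamma> ` topspace (dimer_complex \<Gamma>)"
    by (simp_all add: image odd_cycle_free_labelings_def)
qed

end
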